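(* Let $G$ be a minimal weighted graph, and let $\{G_1,\dots,G_p\}$ and $\{H_1,\dots,H_r\}$ be two pseudofactorizations of $G$ into irreducible weighted graphs. Then the two pseudofactorizations are equivalent in the following sense: there is a bijection between the two families of pseudofactors such that corresponding pseudofactors are isomorphic (i.e. $p=r$, and after reordering $G_i$ is isomorphic to $H_i$ for all $1\le i\le p$).
   Context: Graphs are finite, connected, undirected weighted graphs $G=(V,E,w)$ with $w:E\to\mathbb{R}_{>0}$; $d_G$ denotes the shortest-path metric (minimum total edge weight of a path). $G$ is minimal if $w(uv)=d_G(u,v)$ for every edge $uv\in E$. An isomorphism of weighted graphs is a bijection of vertices preserving adjacency, non-adjacency and edge weights. Cartesian product: for $G_i=(V_i,E_i,w_i)$, $1\le i\le m$, the graph $\prod_{i=1}^m G_i$ has vertex set $V_1\times\cdots\times V_m$; $(u_1,\dots,u_m)(v_1,\dots,v_m)$ is an edge iff there is exactly one index $\ell$ with $u_\ell v_\ell\in E_\ell$ and $u_i=v_i$ for all $i\ne\ell$, and its weight is then $w_\ell(u_\ell v_\ell)$. Pseudofactorization: a finite family $\{G_1^*,\dots,G_m^*\}$ (repetitions allowed) is a pseudofactorization of $G$, and its members are pseudofactors, if with $G^*=\prod_{i=1}^m G_i^*$ there is a map $\pi=(\pi_1,\dots,\pi_m):V(G)\to V(G^* )$ such that: (1) $d_G(u,u')=d_{G^*}(\pi(u),\pi(u'))$ for all $u,u'\in V(G)$; (2) $uv\in E(G)$ implies $\pi(u)\pi(v)\in E(G^* )$ and $w_G(uv)=w_{G^*}(\pi(u)\pi(v))$;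 (3) every vertex of $G_i^*$ is in the image of $\pi_i$, for each $i$; (4) every edge of every $G_i^*$ is the parent of some edge of $G$, where the parent edge of $uv\in E(G)$ under $\pi$ is the edge $\pi_\ell(u)\pi_\ell(v)\in E(G_\ell^* )$ for the unique $\ell$ with $\pi_\ell(u)\neq\pi_\ell(v)$. By convention a pseudofactorization does not include the one-vertex graph $K_1$ unless $G=K_1$. $G$ is irreducible if every pseudofactorization of $G$ includes (a graph isomorphic to) $G$ as a pseudofactor.
   Formalization: For G = K_1 the only pseudofactorization admitted is the family {K_1}; the empty family and families with several copies of K_1 are excluded, since otherwise {K_1} and {K_1, K_1} would both be pseudofactorizations into irreducible graphs with different numbers of members. *)

theory Defs
  imports Complex_Main "HOL-Library.FuncSet"
begin

section \<open>Weighted graphs\<close>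

text \<open>Edges are two-element sets of vertices; the weight function is only meaningful on edges.\<close>

record 'a wgraph =
  vertices :: "'a set"
  edges :: "'a set set"
  weight :: "'a set \<Rightarrow> real"

definition gpath :: "'a wgraph \<Rightarrow> 'a \<Rightarrow> 'a list \<Rightarrow> 'a \<Rightarrow> bool" where
  "gpath G u p v \<longleftrightarrow>
     p \<noteq> [] \<and> hd p = u \<and> last p = v \<and> set p \<subseteq> vertices G \<and> distinct p \<and>
     successively (\<lambda>x y. {x, y} \<in> edges G) p"

fun path_weight :: "'a wgraph \<Rightarrow> 'a list \<Rightarrow> real" where
  "path_weight G (x # y # p) = weight G {x, y} + path_weight G (y # p)"
| "path_weight G p = 0"

locale weighted_graph =
  fixes G :: "'a wgraph"
  assumes finite_vertices: "finite (vertices G)"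
    and vertices_nonempty: "vertices G \<noteq> {}"
    and edge_subset: "e \<in> edges G \<Longrightarrow> e \<subseteq> vertices G"
    and edge_card: "e \<in> edges G \<Longrightarrow> card e = 2"
    and weight_pos: "e \<in> edges G \<Longrightarrow> 0 < weight G e"
    and connected: "u \<in> vertices G \<Longrightarrow> v \<in> vertices G \<Longrightarrow> \<exists>p. gpath G u p v"

definition gdist :: "'a wgraph \<Rightarrow> 'a \<Rightarrow> 'a \<Rightarrow> real" where
  "gdist G u v = Min (path_weight G ` {p. gpath G u p v})"

lemma (in weighted_graph) finite_gpaths: "finite {p. gpath G u p v}"
proof (rule finite_subset)
  show "{p. gpath G u p v} \<subseteq> {p. set p \<subseteq> vertices G \<and> length p \<le> card (vertices G)}"
    using finite_vertices by (auto simp: gpath_def distinct_card[symmetric] intro: card_mono)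
  show "finite {p. set p \<subseteq> vertices G \<and> length p \<le> card (vertices G)}"
    by (rule finite_lists_length_le[OF finite_vertices])
qed

definition minimal_wgraph :: "'a wgraph \<Rightarrow> bool" where
  "minimal_wgraph G \<longleftrightarrow> (\<forall>u v. {u, v} \<in> edges G \<longrightarrow> weight G {u, v} = gdist G u v)"

definition wgraph_iso_map :: "('a \<Rightarrow> 'b) \<Rightarrow> 'a wgraph \<Rightarrow> 'b wgraph \<Rightarrow> bool" where
  "wgraph_iso_map f G H \<longleftrightarrow>
     bij_betw f (vertices G) (vertices H) \<and>
     (\<forall>u\<in>vertices G. \<forall>v\<in>vertices G. {u, v} \<in> edges G \<longleftrightarrow> {f u, f v} \<in> edges H) \<and>
     (\<forall>u\<in>vertices G. \<forall>v\<in>vertices G. {u, v} \<in> edges G \<longrightarrow> weight G {u, v} = weight H {f u, f v})"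

definition wgraph_isomorphic :: "'a wgraph \<Rightarrow> 'b wgraph \<Rightarrow> bool" where
  "wgraph_isomorphic G H \<longleftrightarrow> (\<exists>f. wgraph_iso_map f G H)"


section \<open>Cartesian product of a finite family\<close>

text \<open>
  Finite families are indexed by \<open>{..<m}\<close>, and the vertices of a product are the
  extensional functions on \<open>{..<m}\<close>.
\<close>

definition product_edge_at ::
    "nat \<Rightarrow> (nat \<Rightarrow> 'a wgraph) \<Rightarrow> nat \<Rightarrow> (nat \<Rightarrow> 'a) \<Rightarrow> (nat \<Rightarrow> 'a) \<Rightarrow> bool" where
  "product_edge_at m Gs l x y \<longleftrightarrow>
     l < m \<and> {x l, y l} \<in> edges (Gs l) \<and> (\<forall>i<m. i \<noteq> l \<longrightarrow> x i = y i)"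

definition cart_prod :: "nat \<Rightarrow> (nat \<Rightarrow> 'a wgraph) \<Rightarrow> (nat \<Rightarrow> 'a) wgraph" where
  "cart_prod m Gs =
     \<lparr> vertices = (\<Pi>\<^sub>E i\<in>{..<m}. vertices (Gs i)),
       edges = {{x, y} | x y. x \<in> (\<Pi>\<^sub>E i\<in>{..<m}. vertices (Gs i)) \<and>
                              y \<in> (\<Pi>\<^sub>E i\<in>{..<m}. vertices (Gs i)) \<and>
                              (\<exists>!l. product_edge_at m Gs l x y)},
       weight = (\<lambda>e. THE c. \<exists>x y l. e = {x, y} \<and> product_edge_at m Gs l x y \<and>
                                    c = weight (Gs l) {x l, y l}) \<rparr>"

lemma product_edge_at_commute: "product_edge_at m Gs l x y \<longleftrightarrow> product_edge_at m Gs l y x"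
  by (auto simp: product_edge_at_def insert_commute)

lemma product_edge_at_unique:
  assumes "\<And>i. i < m \<Longrightarrow> weighted_graph (Gs i)"
    and "product_edge_at m Gs l x y" and "product_edge_at m Gs k x y"
  shows "k = l"
proof (rule ccontr)
  assume "k \<noteq> l"
  then have "x l = y l" "l < m" "{x l, y l} \<in> edges (Gs l)"
    using assms(2,3) by (auto simp: product_edge_at_def)
  then show False
    using weighted_graph.edge_card[OF assms(1), of l "{x l, y l}"] by simp
qed

lemma edges_cart_prod_iff:
  "{x, y} \<in> edges (cart_prod m Gs) \<longleftrightarrow>
     x \<in> vertices (cart_prod m Gs) \<and> y \<in> vertices (cart_prod m Gs) \<and>
     (\<exists>!l. product_edge_at m Gs l x y)"
proof
  assume "{x, y} \<in> edges (cart_prod m Gs)"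
  then show "x \<in> vertices (cart_prod m Gs) \<and> y \<in> vertices (cart_prod m Gs) \<and>
     (\<exists>!l. product_edge_at m Gs l x y)"
    unfolding cart_prod_def
    by (auto simp: doubleton_eq_iff product_edge_at_commute[of _ _ _ y x])
next
  assume "x \<in> vertices (cart_prod m Gs) \<and> y \<in> vertices (cart_prod m Gs) \<and>
     (\<exists>!l. product_edge_at m Gs l x y)"
  then show "{x, y} \<in> edges (cart_prod m Gs)"
    unfolding cart_prod_def wgraph.simps by blast
qed

lemma weight_cart_prod:
  assumes "\<And>i. i < m \<Longrightarrow> weighted_graph (Gs i)" and l: "product_edge_at m Gs l x y"
  shows "weight (cart_prod m Gs) {x, y} = weight (Gs l) {x l, y l}"
proof -
  have "(THE c. \<exists>x' y' k. {x, y} = {x', y'} \<and> product_edge_at m Gs k x' y' \<and>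
          c = weight (Gs k) {x' k, y' k}) = weight (Gs l) {x l, y l}"
  proof (rule the_equality)
    show "\<exists>x' y' k. {x, y} = {x', y'} \<and> product_edge_at m Gs k x' y' \<and>
          weight (Gs l) {x l, y l} = weight (Gs k) {x' k, y' k}"
      using l by blast
  next
    fix c
    assume "\<exists>x' y' k. {x, y} = {x', y'} \<and> product_edge_at m Gs k x' y' \<and>
          c = weight (Gs k) {x' k, y' k}"
    then obtain x' y' k where *: "{x, y} = {x', y'}" "product_edge_at m Gs k x' y'"
          "c = weight (Gs k) {x' k, y' k}"
      by blast
    then have "product_edge_at m Gs k x y" "c = weight (Gs k) {x k, y k}"
      by (auto simp: doubleton_eq_iff product_edge_at_commute insert_commute)
    then show "c = weight (Gs l) {x l, y l}"
      using product_edge_at_unique[OF assms] by auto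
  qed
  then show ?thesis
    by (simp add: cart_prod_def)
qed


section \<open>Pseudofactorizations\<close>

text \<open>
  A parent edge is recorded together with the index of the factor it lies in, since the
  members of a family may share vertices and edges, or even coincide.
\<close>

definition parent_edge :: "nat \<Rightarrow> ('a \<Rightarrow> nat \<Rightarrow> 'b) \<Rightarrow> 'a \<Rightarrow> 'a \<Rightarrow> nat \<times> 'b set" where
  "parent_edge m \<pi> u v = (let l = (THE l. l < m \<and> \<pi> u l \<noteq> \<pi> v l) in (l, {\<pi> u l, \<pi> v l}))"

definition pseudofactor_map ::
    "('a \<Rightarrow> nat \<Rightarrow> 'b) \<Rightarrow> nat \<Rightarrow> (nat \<Rightarrow> 'b wgraph) \<Rightarrow> 'a wgraph \<Rightarrow> bool" where
  "pseudofactor_map \<pi> m Gs G \<longleftrightarrow>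
     \<pi> ` vertices G \<subseteq> vertices (cart_prod m Gs) \<and>
     (\<forall>u\<in>vertices G. \<forall>v\<in>vertices G. gdist G u v = gdist (cart_prod m Gs) (\<pi> u) (\<pi> v)) \<and>
     (\<forall>u v. {u, v} \<in> edges G \<longrightarrow>
        {\<pi> u, \<pi> v} \<in> edges (cart_prod m Gs) \<and>
        weight G {u, v} = weight (cart_prod m Gs) {\<pi> u, \<pi> v}) \<and>
     (\<forall>i<m. \<forall>x\<in>vertices (Gs i). \<exists>u\<in>vertices G. \<pi> u i = x) \<and>
     (\<forall>i<m. \<forall>e\<in>edges (Gs i). \<exists>u v. {u, v} \<in> edges G \<and> parent_edge m \<pi> u v = (i, e))"

definition one_vertex :: "'a wgraph \<Rightarrow> bool" where
  "one_vertex G \<longleftrightarrow> card (vertices G) = 1"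

text \<open>
  The one-vertex graph \<open>K\<^sub>1\<close> is not allowed as a pseudofactor, except in the family
  consisting of \<open>K\<^sub>1\<close> alone, which is the only pseudofactorization of \<open>K\<^sub>1\<close>: the
  empty family and families with several copies of \<open>K\<^sub>1\<close> are excluded.
\<close>

definition pseudofactorization :: "nat \<Rightarrow> (nat \<Rightarrow> 'b wgraph) \<Rightarrow> 'a wgraph \<Rightarrow> bool" where
  "pseudofactorization m Gs G \<longleftrightarrow>
     1 \<le> m \<and> (\<forall>i<m. weighted_graph (Gs i)) \<and>
     (\<exists>\<pi>. pseudofactor_map \<pi> m Gs G) \<and>
     (\<forall>i<m. one_vertex (Gs i) \<longrightarrow> one_vertex G \<and> m = 1)"

text \<open>
  A definition cannot quantify over types, so the pseudofactors below have the same vertex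
  type as \<open>G\<close>. This is no restriction, because a pseudofactor has at most as many vertices
  as \<open>G\<close>; see \<open>irreducible_wgraph_any_type\<close>.
\<close>

definition irreducible_wgraph :: "'a wgraph \<Rightarrow> bool" where
  "irreducible_wgraph G \<longleftrightarrow>
     (\<forall>m. \<forall>Gs :: nat \<Rightarrow> 'a wgraph.
        pseudofactorization m Gs G \<longrightarrow> (\<exists>i<m. wgraph_isomorphic (Gs i) G))"

subsection \<open>Independence of the vertex types\<close>

lemma gpath_iso:
  assumes f: "wgraph_iso_map f G H" and p: "gpath G u p v"
  shows "gpath H (f u) (map f p) (f v)" and "path_weight H (map f p) = path_weight G p"
proof -
  have bij: "bij_betw f (vertices G) (vertices H)"
    using f by (simp add: wgraph_iso_map_def)
  have sub: "set p \<subseteq> vertices G" and succ: "successively (\<lambda>x y. {x, y} \<in> edges G) p"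
    using p by (auto simp: gpath_def)
  have "successively (\<lambda>x y. {f x, f y} \<in> edges H) p"
    using succ sub f
    by (induction p rule: induct_list012) (auto simp: wgraph_iso_map_def)
  then show "gpath H (f u) (map f p) (f v)"
    using p bij sub
    by (auto simp: gpath_def hd_map last_map distinct_map successively_map bij_betw_def
        intro: inj_on_subset)
  show "path_weight H (map f p) = path_weight G p"
    using succ sub f
    by (induction p rule: induct_list012) (auto simp: wgraph_iso_map_def)
qed

lemma wgraph_iso_map_inv:
  assumes f: "wgraph_iso_map f G H"
  shows "wgraph_iso_map (inv_into (vertices G) f) H G"
proof -
  have bij: "bij_betw f (vertices G) (vertices H)"
    using f by (simp add: wgraph_iso_map_def)
  then have "f (inv_into (vertices G) f x) = x" "inv_into (vertices G) f x \<in> vertices G"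
    if "x \<in> vertices H" for x
    using that by (auto simp: bij_betw_inv_into_right intro: inv_into_into
        simp: bij_betw_def)
  with f bij show ?thesis
    unfolding wgraph_iso_map_def by (simp add: bij_betw_inv_into)
qed

lemma wgraph_iso_map_comp:
  assumes "wgraph_iso_map f G H" and "wgraph_iso_map g H K"
  shows "wgraph_iso_map (g \<circ> f) G K"
proof -
  have "f u \<in> vertices H" if "u \<in> vertices G" for u
    using assms(1) that by (auto simp: wgraph_iso_map_def bij_betw_def)
  then show ?thesis
    using assms by (auto simp: wgraph_iso_map_def intro: bij_betw_trans)
qed

lemma gdist_iso:
  assumes f: "wgraph_iso_map f G H" and uv: "u \<in> vertices G" "v \<in> vertices G"
  shows "gdist H (f u) (f v) = gdist G u v"
proof -
  define g where "g = inv_into (vertices G) f"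
  have g: "wgraph_iso_map g H G"
    using wgraph_iso_map_inv[OF f] by (simp add: g_def)
  have gf: "g (f u) = u" "g (f v) = v"
    using f uv by (auto simp: g_def wgraph_iso_map_def bij_betw_def)
  have "path_weight H ` {p. gpath H (f u) p (f v)} = path_weight G ` {p. gpath G u p v}"
    (is "?A = ?B")
  proof
    show "?A \<subseteq> ?B"
      using gpath_iso[OF g] gf by (force simp: image_iff)
    show "?B \<subseteq> ?A"
      using gpath_iso[OF f] by (force simp: image_iff)
  qed
  then show ?thesis
    by (simp add: gdist_def)
qed

lemma cart_prod_iso:
  assumes iso: "\<And>i. i < m \<Longrightarrow> wgraph_iso_map (f i) (Gs i) (Hs i)"
    and G: "\<And>i. i < m \<Longrightarrow> weighted_graph (Gs i)"
    and H: "\<And>i. i < m \<Longrightarrow> weighted_graph (Hs i)"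
  shows "wgraph_iso_map (\<lambda>x. \<lambda>i\<in>{..<m}. f i (x i)) (cart_prod m Gs) (cart_prod m Hs)"
    (is "wgraph_iso_map ?F ?G ?H")
proof -
  have bij: "bij_betw (f i) (vertices (Gs i)) (vertices (Hs i))" if "i < m" for i
    using iso[OF that] by (simp add: wgraph_iso_map_def)
  have inG: "x i \<in> vertices (Gs i)" if "x \<in> vertices ?G" "i < m" for x i
    using that by (auto simp: cart_prod_def)
  have F_in: "?F x \<in> vertices ?H" if "x \<in> vertices ?G" for x
    using bij inG[OF that] by (auto simp: cart_prod_def bij_betw_def)
  have edge: "product_edge_at m Hs l (?F x) (?F y) \<longleftrightarrow> product_edge_at m Gs l x y"
    if x: "x \<in> vertices ?G" and y: "y \<in> vertices ?G" for x y l
  proof -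
    have "f i (x i) = f i (y i) \<longleftrightarrow> x i = y i" if "i < m" for i
      using bij[OF that] inG[OF x that] inG[OF y that] by (auto simp: bij_betw_def inj_on_eq_iff)
    moreover have "{f i (x i), f i (y i)} \<in> edges (Hs i) \<longleftrightarrow> {x i, y i} \<in> edges (Gs i)"
      if "i < m" for i
      using iso[OF that] inG[OF x that] inG[OF y that] by (auto simp: wgraph_iso_map_def)
    ultimately show ?thesis
      by (auto simp: product_edge_at_def)
  qed
  have weight: "weight ?G {x, y} = weight ?H {?F x, ?F y}"
    if x: "x \<in> vertices ?G" and y: "y \<in> vertices ?G" and e: "{x, y} \<in> edges ?G" for x y
  proof -
    obtain l where l: "product_edge_at m Gs l x y"
      using e by (auto simp: edges_cart_prod_iff)
    then have "product_edge_at m Hs l (?F x) (?F y)"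
      by (simp add: edge[OF x y])
    then have "weight ?H {?F x, ?F y} = weight (Hs l) {?F x l, ?F y l}"
      using weight_cart_prod[of m Hs l "?F x" "?F y"] H by blast
    moreover have "weight ?G {x, y} = weight (Gs l) {x l, y l}"
      by (rule weight_cart_prod[OF G l])
    moreover have "l < m" "{x l, y l} \<in> edges (Gs l)"
      using l by (auto simp: product_edge_at_def)
    moreover have "weight (Gs l) {x l, y l} = weight (Hs l) {f l (x l), f l (y l)}"
      using iso[OF \<open>l < m\<close>] \<open>{x l, y l} \<in> edges (Gs l)\<close> inG[OF x \<open>l < m\<close>] inG[OF y \<open>l < m\<close>]
      unfolding wgraph_iso_map_def by blast
    ultimately show ?thesis
      by simp
  qed
  have inj: "inj_on ?F (vertices ?G)"
  proof (rule inj_onI)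
    fix x y assume x: "x \<in> vertices ?G" and y: "y \<in> vertices ?G" and eq: "?F x = ?F y"
    have "x i = y i" if "i < m" for i
    proof -
      have "f i (x i) = f i (y i)"
        using fun_cong[OF eq, of i] that by simp
      then show ?thesis
        using bij[OF that] inG[OF x that] inG[OF y that] by (auto simp: bij_betw_def inj_on_eq_iff)
    qed
    then show "x = y"
      using x y by (auto simp: cart_prod_def intro: PiE_ext)
  qed
  have surj: "y \<in> ?F ` vertices ?G" if y: "y \<in> vertices ?H" for y
  proof
    let ?x = "\<lambda>i\<in>{..<m}. inv_into (vertices (Gs i)) (f i) (y i)"
    have yi: "y i \<in> vertices (Hs i)" if "i < m" for i
      using y that by (auto simp: cart_prod_def)
    show "?x \<in> vertices ?G"
      using yi bij by (auto simp: cart_prod_def bij_betw_def intro!: inv_into_into)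
    have "y \<in> extensional {..<m}"
      using y by (auto simp: cart_prod_def PiE_def)
    then show "y = ?F ?x"
      by (auto simp: fun_eq_iff restrict_def extensional_def
          bij_betw_inv_into_right[OF bij yi])
  qed
  have "bij_betw ?F (vertices ?G) (vertices ?H)"
    using inj F_in surj unfolding bij_betw_def by blast
  moreover have "{x, y} \<in> edges ?G \<longleftrightarrow> {?F x, ?F y} \<in> edges ?H"
    if "x \<in> vertices ?G" "y \<in> vertices ?G" for x y
    using that F_in unfolding edges_cart_prod_iff by (simp add: edge del: restrict_apply)
  ultimately show ?thesis
    unfolding wgraph_iso_map_def using weight by blast
qed

lemma pseudofactorization_iso:
  assumes pf: "pseudofactorization m Gs G"
    and iso: "\<And>i. i < m \<Longrightarrow> wgraph_iso_map (f i) (Gs i) (Hs i)"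
    and H: "\<And>i. i < m \<Longrightarrow> weighted_graph (Hs i)"
    and G: "weighted_graph G"
  shows "pseudofactorization m Hs G"
proof -
  obtain \<pi> where \<pi>: "pseudofactor_map \<pi> m Gs G"
    using pf by (auto simp: pseudofactorization_def)
  have Gs: "weighted_graph (Gs i)" if "i < m" for i
    using pf that by (auto simp: pseudofactorization_def)
  have bij: "bij_betw (f i) (vertices (Gs i)) (vertices (Hs i))" if "i < m" for i
    using iso[OF that] by (simp add: wgraph_iso_map_def)
  let ?F = "\<lambda>x. \<lambda>i\<in>{..<m}. f i (x i)"
  let ?P = "\<lambda>u. ?F (\<pi> u)"
  have F: "wgraph_iso_map ?F (cart_prod m Gs) (cart_prod m Hs)"
    by (rule cart_prod_iso[OF iso Gs H])
  have \<pi>_in: "\<pi> u \<in> vertices (cart_prod m Gs)" if "u \<in> vertices G" for u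
    using \<pi> that by (auto simp: pseudofactor_map_def)
  have edge_in: "u \<in> vertices G" "v \<in> vertices G" if "{u, v} \<in> edges G" for u v
    using weighted_graph.edge_subset[OF G that] by auto
  have neq: "f i (\<pi> u i) \<noteq> f i (\<pi> v i) \<longleftrightarrow> \<pi> u i \<noteq> \<pi> v i"
    if "i < m" "u \<in> vertices G" "v \<in> vertices G" for i u v
  proof -
    have "\<pi> u i \<in> vertices (Gs i)" "\<pi> v i \<in> vertices (Gs i)"
      using \<pi>_in[OF that(2)] \<pi>_in[OF that(3)] that(1) by (auto simp: cart_prod_def)
    then show ?thesis
      using bij[OF that(1)] by (auto simp: bij_betw_def inj_on_eq_iff)
  qed
  have parent: "\<exists>u v. {u, v} \<in> edges G \<and> parent_edge m ?P u v = (i, e)"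
    if i: "i < m" and e: "e \<in> edges (Hs i)" for i e
  proof -
    let ?g = "inv_into (vertices (Gs i)) (f i)"
    obtain a b where ab: "e = {a, b}"
      using weighted_graph.edge_card[OF H[OF i] e] by (auto simp: card_2_iff)
    have abH: "a \<in> vertices (Hs i)" "b \<in> vertices (Hs i)"
      using weighted_graph.edge_subset[OF H[OF i] e] by (auto simp: ab)
    have "{?g a, ?g b} \<in> edges (Gs i)"
      using wgraph_iso_map_inv[OF iso[OF i]] e abH by (auto simp: ab wgraph_iso_map_def)
    then obtain u v where uv: "{u, v} \<in> edges G" "parent_edge m \<pi> u v = (i, {?g a, ?g b})"
      using \<pi> i unfolding pseudofactor_map_def by blast
    have "(\<lambda>l. l < m \<and> ?P u l \<noteq> ?P v l) = (\<lambda>l. l < m \<and> \<pi> u l \<noteq> \<pi> v l)"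
      using neq[OF _ edge_in[OF uv(1)]] by auto
    then have "parent_edge m ?P u v = (i, {?P u i, ?P v i})" "{\<pi> u i, \<pi> v i} = {?g a, ?g b}"
      using uv(2) by (auto simp only: parent_edge_def Let_def prod.inject)
    moreover have "{?P u i, ?P v i} = f i ` {\<pi> u i, \<pi> v i}"
      using i by simp
    moreover have "f i ` {?g a, ?g b} = e"
      using bij_betw_inv_into_right[OF bij[OF i]] abH by (simp add: ab)
    ultimately show ?thesis
      using uv(1) by auto
  qed
  have "pseudofactor_map ?P m Hs G"
    unfolding pseudofactor_map_def
  proof (intro conjI ballI allI impI)
    show "?P ` vertices G \<subseteq> vertices (cart_prod m Hs)"
      using F \<pi>_in unfolding wgraph_iso_map_def bij_betw_def by blast
  next
    fix u v assume "u \<in> vertices G" "v \<in> vertices G"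
    then show "gdist G u v = gdist (cart_prod m Hs) (?P u) (?P v)"
      using \<pi> gdist_iso[OF F \<pi>_in \<pi>_in] by (simp add: pseudofactor_map_def)
  next
    fix u v assume e: "{u, v} \<in> edges G"
    then have *: "{\<pi> u, \<pi> v} \<in> edges (cart_prod m Gs)"
      "weight G {u, v} = weight (cart_prod m Gs) {\<pi> u, \<pi> v}"
      using \<pi> by (auto simp: pseudofactor_map_def)
    then show "{?P u, ?P v} \<in> edges (cart_prod m Hs)"
      using F \<pi>_in edge_in[OF e] unfolding wgraph_iso_map_def by blast
    show "weight G {u, v} = weight (cart_prod m Hs) {?P u, ?P v}"
      using * F \<pi>_in edge_in[OF e] unfolding wgraph_iso_map_def by simp
  next
    fix i y assume i: "i < m" and y: "y \<in> vertices (Hs i)"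
    then obtain x where x: "x \<in> vertices (Gs i)" "y = f i x"
      using bij[OF i] by (auto simp: bij_betw_def)
    then obtain u where "u \<in> vertices G" "\<pi> u i = x"
      using \<pi> i unfolding pseudofactor_map_def by blast
    then show "\<exists>u\<in>vertices G. ?P u i = y"
      using x i by auto
  next
    fix i e assume "i < m" "e \<in> edges (Hs i)"
    then show "\<exists>u v. {u, v} \<in> edges G \<and> parent_edge m ?P u v = (i, e)"
      by (rule parent)
  qed
  then show ?thesis
    using pf H bij_betw_same_card[OF bij]
    unfolding pseudofactorization_def one_vertex_def by auto
qed

lemma wgraph_transport:
  assumes G: "weighted_graph G" and f: "inj_on f (vertices G)"
  shows "\<exists>H. weighted_graph H \<and> wgraph_iso_map f G H"
proof -
  interpret weighted_graph G by (rule G)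
  define g where "g = inv_into (vertices G) f"
  define H where "H = \<lparr> vertices = f ` vertices G, edges = (`) f ` edges G,
                        weight = (\<lambda>e. weight G (g ` e)) \<rparr>"
  have gf: "g ` f ` e = e" if "e \<subseteq> vertices G" for e
    using that f by (force simp: g_def image_image subset_iff)
  have "{u, v} \<in> edges G \<longleftrightarrow> {f u, f v} \<in> edges H"
    if "u \<in> vertices G" "v \<in> vertices G" for u v
  proof
    assume "{f u, f v} \<in> edges H"
    then obtain e where "e \<in> edges G" "f ` e = f ` {u, v}"
      by (auto simp: H_def)
    then show "{u, v} \<in> edges G"
      using gf[of e] gf[of "{u, v}"] edge_subset[of e] that by auto
  qed (auto simp: H_def image_iff intro!: bexI[of _ "{u, v}"])
  moreover have "weight G {u, v} = weight H {f u, f v}"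
    if "u \<in> vertices G" "v \<in> vertices G" for u v
    using gf[of "{u, v}"] that by (simp add: H_def)
  ultimately have iso: "wgraph_iso_map f G H"
    using f by (auto simp: wgraph_iso_map_def bij_betw_def H_def)
  have "weighted_graph H"
  proof
    show "finite (vertices H)" "vertices H \<noteq> {}"
      using finite_vertices vertices_nonempty by (auto simp: H_def)
  next
    fix e assume "e \<in> edges H"
    then obtain d where d: "d \<in> edges G" "e = f ` d"
      by (auto simp: H_def)
    then show "e \<subseteq> vertices H"
      using edge_subset by (auto simp: H_def)
    show "card e = 2"
      using d edge_card[of d] edge_subset[of d] f by (auto simp: card_image inj_on_subset)
    show "0 < weight H e"
      using d weight_pos[of d] gf[of d] edge_subset[of d] by (simp add: H_def)
  next
    fix u v assume "u \<in> vertices H" "v \<in> vertices H"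
    then obtain a b where "a \<in> vertices G" "u = f a" "b \<in> vertices G" "v = f b"
      by (auto simp: H_def)
    then show "\<exists>p. gpath H u p v"
      using connected[of a b] gpath_iso(1)[OF iso] by blast
  qed
  with iso show ?thesis
    by blast
qed

lemma irreducible_wgraph_any_type:
  fixes G :: "'a wgraph" and Hs :: "nat \<Rightarrow> 'b wgraph"
  assumes G: "weighted_graph G" and irr: "irreducible_wgraph G"
    and pf: "pseudofactorization m Hs G"
  shows "\<exists>i<m. wgraph_isomorphic (Hs i) G"
proof -
  obtain \<pi> where \<pi>: "pseudofactor_map \<pi> m Hs G"
    using pf by (auto simp: pseudofactorization_def)
  define f where "f i = inv_into (vertices G) (\<lambda>u. \<pi> u i)" for i
  have "inj_on (f i) (vertices (Hs i))" if "i < m" for i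
  proof -
    have "vertices (Hs i) \<subseteq> (\<lambda>u. \<pi> u i) ` vertices G"
      using \<pi> that by (force simp: pseudofactor_map_def)
    then show ?thesis
      unfolding f_def by (rule inj_on_inv_into)
  qed
  then have "\<exists>K. weighted_graph K \<and> wgraph_iso_map (f i) (Hs i) K" if "i < m" for i
    using pf that by (intro wgraph_transport) (auto simp: pseudofactorization_def)
  then obtain Ks where Ks: "\<And>i. i < m \<Longrightarrow> weighted_graph (Ks i)"
    "\<And>i. i < m \<Longrightarrow> wgraph_iso_map (f i) (Hs i) (Ks i)"
    by metis
  have "pseudofactorization m Ks G"
    by (rule pseudofactorization_iso[OF pf Ks(2) Ks(1) G])
  then obtain i where "i < m" "wgraph_isomorphic (Ks i) G"
    using irr by (auto simp: irreducible_wgraph_def)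
  then show ?thesis
    unfolding wgraph_isomorphic_def by (blast intro: wgraph_iso_map_comp[OF Ks(2)])
qed

end

theory Submission imports Defs
begin

text \<open>
  A pseudofactorization colours every edge of \<open>G\<close> by the index of the factor that contains its
  parent. Since distances in a product add up over the coordinates, edges of different colours
  are never in the Djokovic--Winkler relation. The pseudofactor of a colour is determined by its
  colour class alone: \<open>\<pi>\<close> turns its distance into the least weight that a path of \<open>G\<close> has in
  that colour.

  Conversely (Graham and Winkler), a colouring of a minimal graph such that edges of different
  colours are never related comes from a pseudofactorization, because shortest paths minimize the
  weight in each colour simultaneously. If every colour occurs and there are at least two, each
  factor has fewer edges than the graph, so the graph is not irreducible. Hence, on a colour class
  of a pseudofactorization into irreducible graphs, the colouring of any other pseudofactorization
  is constant, and two such pseudofactorizations have the same colour classes.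
\<close>

section \<open>Distances and potentials\<close>

lemma path_weight_split:
  "path_weight G (xs @ y # ys) = path_weight G (xs @ [y]) + path_weight G (y # ys)"
  by (induction xs rule: induct_list012) auto

lemma path_weight_nonneg:
  assumes "\<And>e. e \<in> edges G \<Longrightarrow> 0 \<le> weight G e" and "successively (\<lambda>x y. {x, y} \<in> edges G) p"
  shows "0 \<le> path_weight G p"
  using assms(2) by (induction p rule: induct_list012) (auto simp: assms(1))

lemma gpath_refl: "u \<in> vertices G \<Longrightarrow> gpath G u [u] u"
  by (simp add: gpath_def)

text \<open>Paths are repetition-free, so \<open>z\<close> cannot be appended when \<open>p\<close>
  already visits it. In that case \<open>p\<close> is cut at \<open>z\<close>, which adds no weight
  because weights are nonnegative.\<close>

lemma gpath_extend:
  assumes nonneg: "\<And>e. e \<in> edges G \<Longrightarrow> 0 \<le> weight G e"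
    and p: "gpath G u p v" and e: "{v, z} \<in> edges G" and z: "z \<in> vertices G"
  shows "\<exists>q. gpath G u q z \<and> path_weight G q \<le> path_weight G p + weight G {v, z}"
proof (cases "z \<in> set p")
  case True
  then obtain xs ys where xs: "p = xs @ z # ys"
    by (auto simp: in_set_conv_decomp)
  have succ: "successively (\<lambda>x y. {x, y} \<in> edges G) (xs @ [z])"
    "successively (\<lambda>x y. {x, y} \<in> edges G) (z # ys)"
    using p by (auto simp: gpath_def xs successively_append_iff)
  have "gpath G u (xs @ [z]) z"
    using p succ by (cases xs) (auto simp: gpath_def xs)
  moreover have "path_weight G (xs @ [z]) \<le> path_weight G p"
    using path_weight_nonneg[OF nonneg succ(2)] by (simp add: xs path_weight_split[of G xs z ys])
  ultimately show ?thesis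
    using nonneg[OF e] by (intro exI[of _ "xs @ [z]"]) auto
next
  case False
  obtain xs where xs: "p = xs @ [v]"
    using p by (metis append_butlast_last_id gpath_def)
  have "gpath G u (p @ [z]) z"
    using p e z False by (auto simp: gpath_def successively_append_iff)
  moreover have "path_weight G (p @ [z]) = path_weight G p + weight G {v, z}"
    by (simp add: xs path_weight_split[of G xs v "[z]"])
  ultimately show ?thesis
    by (intro exI[of _ "p @ [z]"]) auto
qed

text \<open>Zero weights are allowed here because the argument below sets the weight of all edges
  outside a given colour class to \<open>0\<close>.\<close>

locale nonneg_wgraph =
  fixes G :: "'a wgraph"
  assumes fin: "finite (vertices G)"
    and edge_vertices: "{u, v} \<in> edges G \<Longrightarrow> u \<in> vertices G \<and> v \<in> vertices G"
    and nonneg: "e \<in> edges G \<Longrightarrow> 0 \<le> weight G e"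
    and conn: "u \<in> vertices G \<Longrightarrow> v \<in> vertices G \<Longrightarrow> \<exists>p. gpath G u p v"
begin

lemma finite_paths: "finite {p. gpath G u p v}"
proof (rule finite_subset)
  show "{p. gpath G u p v} \<subseteq> {p. set p \<subseteq> vertices G \<and> length p \<le> card (vertices G)}"
    using fin by (auto simp: gpath_def distinct_card[symmetric] intro: card_mono)
qed (rule finite_lists_length_le[OF fin])

lemma gdist_attained:
  assumes "u \<in> vertices G" "v \<in> vertices G"
  obtains p where "gpath G u p v" "gdist G u v = path_weight G p"
proof -
  have "gdist G u v \<in> path_weight G ` {p. gpath G u p v}"
    unfolding gdist_def using conn[OF assms] finite_paths by (intro Min_in) auto
  then show thesis
    using that by blast
qed

lemma gdist_le_path_weight: "gpath G u p v \<Longrightarrow> gdist G u v \<le> path_weight G p"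
  unfolding gdist_def using finite_paths by (intro Min_le) auto

lemma potential_le_path_weight:
  assumes "\<And>x y. {x, y} \<in> edges G \<Longrightarrow> h x \<le> h y + weight G {x, y}"
    and "successively (\<lambda>x y. {x, y} \<in> edges G) p" "p \<noteq> []"
  shows "h (hd p) \<le> h (last p) + path_weight G p"
  using assms(2,3)
proof (induction p rule: induct_list012)
  case (3 x y zs)
  then show ?case
    using assms(1)[of x y] by auto
qed auto

text \<open>The bound telescopes along a shortest path. It is the duality behind the distance
  comparisons below: a function that changes by at most the weight across every edge bounds the
  distance from below.\<close>

lemma potential_le_gdist:
  assumes "\<And>x y. {x, y} \<in> edges G \<Longrightarrow> h x \<le> h y + weight G {x, y}"
    and "u \<in> vertices G" "v \<in> vertices G"
  shows "h u \<le> h v + gdist G u v"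
proof -
  obtain p where "gpath G u p v" "gdist G u v = path_weight G p"
    using gdist_attained assms(2,3) by blast
  then show ?thesis
    using potential_le_path_weight[where h = h, OF assms(1), of p] by (auto simp: gpath_def)
qed

lemma connected_induct:
  assumes "u \<in> vertices G" "v \<in> vertices G" and "P u"
    and step: "\<And>x y. {x, y} \<in> edges G \<Longrightarrow> P x \<Longrightarrow> P y"
  shows "P v"
proof -
  have "P (last p)" if "p \<noteq> []" "P (hd p)" "successively (\<lambda>x y. {x, y} \<in> edges G) p" for p
    using that
  proof (induction p rule: induct_list012)
    case (3 x y zs)
    then show ?case
      using step[of x y] by simp
  qed auto
  then show ?thesis
    using conn[OF assms(1,2)] \<open>P u\<close> unfolding gpath_def by blast
qed

lemma gdist_nonneg: "u \<in> vertices G \<Longrightarrow> v \<in> vertices G \<Longrightarrow> 0 \<le> gdist G u v"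
  using potential_le_gdist[where h = "\<lambda>_. 0"] nonneg by simp

lemma gdist_self: "u \<in> vertices G \<Longrightarrow> gdist G u u = 0"
  using gdist_le_path_weight[OF gpath_refl] gdist_nonneg[of u u] by force

lemma gdist_edge_step:
  assumes "u \<in> vertices G" and e: "{x, y} \<in> edges G"
  shows "gdist G u y \<le> gdist G u x + weight G {x, y}"
proof -
  obtain p where p: "gpath G u p x" "gdist G u x = path_weight G p"
    using gdist_attained assms(1) edge_vertices[OF e] by blast
  obtain q where "gpath G u q y" "path_weight G q \<le> path_weight G p + weight G {x, y}"
    using gpath_extend[OF nonneg p(1) e] edge_vertices[OF e] by blast
  then show ?thesis
    using gdist_le_path_weight[of u q y] p(2) by simp
qed

text \<open>By \<open>gdist_edge_step\<close>, \<open>gdist G u\<close> is itself a potential. The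
  last distance runs from \<open>z\<close> to \<open>v\<close>, so that symmetry follows by letting
  two vertices coincide.\<close>

lemma gdist_triangle:
  assumes "u \<in> vertices G" "v \<in> vertices G" "z \<in> vertices G"
  shows "gdist G u z \<le> gdist G u v + gdist G z v"
proof (rule potential_le_gdist[where h = "gdist G u"])
  show "gdist G u x \<le> gdist G u y + weight G {x, y}" if "{x, y} \<in> edges G" for x y
    using gdist_edge_step[OF assms(1), of y x] that by (simp add: insert_commute)
qed (use assms in auto)

lemma gdist_sym:
  assumes "u \<in> vertices G" "v \<in> vertices G"
  shows "gdist G u v = gdist G v u"
  using gdist_triangle[of u u v] gdist_triangle[of v v u] assms by (simp add: gdist_self)

lemma gdist_edge_le: "{x, y} \<in> edges G \<Longrightarrow> gdist G x y \<le> weight G {x, y}"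
  using gdist_edge_step[of x x y] edge_vertices[of x y] by (simp add: gdist_self)

text \<open>With zero weights \<open>gdist\<close> is only a pseudometric; this makes contracting
  the vertices at distance 0 well defined.\<close>

lemma gdist_eq_0_cong:
  assumes "u \<in> vertices G" "v \<in> vertices G" "z \<in> vertices G" "gdist G u v = 0"
  shows "gdist G u z = gdist G v z" "gdist G z u = gdist G z v"
proof -
  show "gdist G u z = gdist G v z"
    using gdist_triangle[of u v z] gdist_triangle[of v u z] gdist_sym[of u v] gdist_sym[of z]
      assms by force
  then show "gdist G z u = gdist G z v"
    using gdist_sym[of z] assms by simp
qed

end

section \<open>Metric facts under positive weights\<close>

context weighted_graph
begin

sublocale nn: nonneg_wgraph G
  using finite_vertices edge_subset weight_pos connected
  by unfold_locales (auto simp: less_imp_le)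

lemma edge_ends:
  assumes "{u, v} \<in> edges G"
  shows "u \<in> vertices G" "v \<in> vertices G" "u \<noteq> v"
  using edge_subset[OF assms] edge_card[OF assms] by auto

lemma edgeE:
  assumes "e \<in> edges G"
  obtains u v where "e = {u, v}" "{u, v} \<in> edges G" "u \<in> vertices G" "v \<in> vertices G"
proof -
  obtain u v where "e = {u, v}"
    using edge_card[OF assms] by (auto simp: card_2_iff)
  then show thesis
    using that[of u v] edge_subset[OF assms] assms by simp
qed

lemma gdist_commute: "u \<in> vertices G \<Longrightarrow> v \<in> vertices G \<Longrightarrow> gdist G u v = gdist G v u"
  by (rule nn.gdist_sym)

lemma finite_edges: "finite (edges G)"
  using finite_vertices edge_subset by (intro finite_subset[of "edges G" "Pow (vertices G)"]) auto

lemma gdist_eq_0_iff: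
  assumes "u \<in> vertices G" "v \<in> vertices G"
  shows "gdist G u v = 0 \<longleftrightarrow> u = v"
proof
  assume 0: "gdist G u v = 0"
  obtain p where p: "gpath G u p v" "gdist G u v = path_weight G p"
    using nn.gdist_attained[OF assms] by blast
  consider "u = v" | y zs where "p = u # y # zs"
    using p(1) by (cases p rule: remdups_adj.cases) (auto simp: gpath_def)
  then show "u = v"
  proof cases
    case (2 y zs)
    then have "{u, y} \<in> edges G" "successively (\<lambda>x y. {x, y} \<in> edges G) (y # zs)"
      using p(1) by (auto simp: gpath_def)
    then have "0 < path_weight G p"
      using weight_pos[of "{u, y}"] path_weight_nonneg[OF nn.nonneg, of "y # zs"]
      by (simp add: 2)
    then show ?thesis
      using p(2) 0 by simp
  qed
qed (use assms nn.gdist_self in auto)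

text \<open>By connectedness nothing but the starting vertex is reachable without edges. Applied to
  a factor other than \<open>K1\<close>, this provides an edge and so an occurrence of its
  colour.\<close>

lemma one_vertex_or_edge: "one_vertex G \<or> edges G \<noteq> {}"
proof (rule disjCI)
  assume no: "\<not> edges G \<noteq> {}"
  obtain u where u: "u \<in> vertices G"
    using vertices_nonempty by blast
  have "v = u" if "v \<in> vertices G" for v
    using nn.connected_induct[OF u that, where P = "\<lambda>v. v = u"] no by simp
  then have "vertices G = {u}"
    using u by blast
  then show "one_vertex G"
    by (simp add: one_vertex_def)
qed

lemma edge_not_one_vertex: "e \<in> edges G \<Longrightarrow> \<not> one_vertex G"
  using edge_card[of e] card_mono[OF finite_vertices edge_subset[of e]]
  by (simp add: one_vertex_def)

end

section \<open>Distances in Cartesian products\<close>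

lemma vertices_cart_prod: "vertices (cart_prod m Gs) = (\<Pi>\<^sub>E i\<in>{..<m}. vertices (Gs i))"
  by (simp add: cart_prod_def)

lemma cart_prod_upd:
  "x \<in> vertices (cart_prod m Gs) \<Longrightarrow> i < m \<Longrightarrow> a \<in> vertices (Gs i) \<Longrightarrow>
    x(i := a) \<in> vertices (cart_prod m Gs)"
  by (auto simp: vertices_cart_prod PiE_def extensional_def)

locale graph_family =
  fixes m :: nat and Gs :: "nat \<Rightarrow> 'b wgraph"
  assumes factor_graph: "i < m \<Longrightarrow> weighted_graph (Gs i)"
begin

abbreviation "P \<equiv> cart_prod m Gs"

lemma product_edge_imp_edge:
  assumes "x \<in> vertices P" "y \<in> vertices P" "product_edge_at m Gs l x y"
  shows "{x, y} \<in> edges P" "weight P {x, y} = weight (Gs l) {x l, y l}"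
proof -
  show "{x, y} \<in> edges P"
    unfolding edges_cart_prod_iff
    using assms product_edge_at_unique[where m = m and Gs = Gs] factor_graph by blast
  show "weight P {x, y} = weight (Gs l) {x l, y l}"
    using factor_graph by (intro weight_cart_prod assms)
qed

lemma upd_edge:
  assumes "x \<in> vertices P" "i < m" "{a, b} \<in> edges (Gs i)"
  shows "{x(i := a), x(i := b)} \<in> edges P"
    "weight P {x(i := a), x(i := b)} = weight (Gs i) {a, b}"
proof -
  have *: "product_edge_at m Gs i (x(i := a)) (x(i := b))"
    using assms by (simp add: product_edge_at_def)
  have "x(i := a) \<in> vertices P" "x(i := b) \<in> vertices P"
    using assms weighted_graph.edge_ends[OF factor_graph] by (auto intro!: cart_prod_upd)
  then show "{x(i := a), x(i := b)} \<in> edges P"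
    "weight P {x(i := a), x(i := b)} = weight (Gs i) {a, b}"
    using product_edge_imp_edge[OF _ _ *] by simp_all
qed

lemma edgeP_E:
  assumes "e \<in> edges P"
  obtains x y l where "e = {x, y}" "x \<in> vertices P" "y \<in> vertices P"
    "product_edge_at m Gs l x y" "l < m" "x l \<noteq> y l" "weight P e = weight (Gs l) {x l, y l}"
    "0 < weight P e"
proof -
  obtain x y where e: "e = {x, y}"
    using assms by (auto simp: cart_prod_def)
  then obtain l where l: "x \<in> vertices P" "y \<in> vertices P" "product_edge_at m Gs l x y"
    using assms edges_cart_prod_iff by blast
  then have "l < m" "{x l, y l} \<in> edges (Gs l)"
    by (auto simp: product_edge_at_def)
  then show thesis
    using that[OF e l] e product_edge_imp_edge(2)[OF l]
      weighted_graph.edge_ends(3)[OF factor_graph, of l "x l" "y l"]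
      weighted_graph.weight_pos[OF factor_graph, of l "{x l, y l}"] by simp
qed

text \<open>Vertices \<open>x\<close> and \<open>y\<close> are linked by changing the coordinates one at a time.\<close>

abbreviation mix :: "nat \<Rightarrow> (nat \<Rightarrow> 'b) \<Rightarrow> (nat \<Rightarrow> 'b) \<Rightarrow> nat \<Rightarrow> 'b" where
  "mix k x y \<equiv> (\<lambda>i. if i < k then y i else x i)"

lemma mix_Suc: "mix (Suc k) x y = (mix k x y)(k := y k)"
  by (auto simp: fun_eq_iff less_Suc_eq)

lemma mix_in: "x \<in> vertices P \<Longrightarrow> y \<in> vertices P \<Longrightarrow> k \<le> m \<Longrightarrow> mix k x y \<in> vertices P"
  by (simp add: vertices_cart_prod PiE_iff extensional_def)

lemma mix_all: "x \<in> vertices P \<Longrightarrow> y \<in> vertices P \<Longrightarrow> mix m x y = y"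
  by (auto simp: vertices_cart_prod PiE_def extensional_def fun_eq_iff)

lemma weighted_graph_cart_prod: "weighted_graph P"
proof
  show "finite (vertices P)"
    unfolding vertices_cart_prod using weighted_graph.finite_vertices[OF factor_graph]
    by (intro finite_PiE) auto
  show "vertices P \<noteq> {}"
    using weighted_graph.vertices_nonempty[OF factor_graph]
    by (simp add: vertices_cart_prod PiE_eq_empty_iff)
next
  fix e assume "e \<in> edges P"
  then show "e \<subseteq> vertices P" "card e = 2" "0 < weight P e"
    by - (erule edgeP_E, auto simp: card_2_iff)+
next
  fix x y assume x: "x \<in> vertices P" and y: "y \<in> vertices P"
  let ?R = "\<lambda>z. \<exists>p. gpath P x p z"
  have nonneg: "0 \<le> weight P e" if "e \<in> edges P" for e
    using that by (rule edgeP_E) simp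
  have extend: "?R z'" if "?R z" "{z, z'} \<in> edges P" for z z'
    using that(1) gpath_extend[OF nonneg _ that(2)] that(2)[unfolded edges_cart_prod_iff] by blast
  \<comment> \<open>One coordinate is moved through its connected factor while the others stay
    fixed.\<close>
  have upd: "?R (z(i := b))" if z: "z \<in> vertices P" "?R z" and i: "i < m" "b \<in> vertices (Gs i)"
    for z i b
  proof -
    interpret Gi: weighted_graph "Gs i" by (rule factor_graph[OF i(1)])
    have "z i \<in> vertices (Gs i)"
      using z i by (auto simp: vertices_cart_prod)
    then show ?thesis
    proof (rule Gi.nn.connected_induct[OF _ i(2)])
      show "?R (z(i := z i))"
        using z by simp
      show "?R (z(i := b))" if "{a, b} \<in> edges (Gs i)" "?R (z(i := a))" for a b
        using extend[OF that(2) upd_edge(1)[OF z(1) i(1) that(1)]] .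
    qed
  qed
  have "?R (mix k x y)" if "k \<le> m" for k
    using that
  proof (induction k)
    case 0
    then show ?case
      using gpath_refl[OF x] by auto
  next
    case (Suc k)
    then show ?case
      unfolding mix_Suc using Suc y by (intro upd mix_in[OF x y]) (auto simp: vertices_cart_prod PiE_iff)
  qed
  from this[of m] show "?R y"
    by (simp add: mix_all[OF x y])
qed

sublocale P: weighted_graph P
  by (rule weighted_graph_cart_prod)

text \<open>Varying coordinate \<open>i\<close> alone maps the edges of \<open>Gs i\<close> to
  product edges of the same weight, so the product distance to \<open>x(i := b)\<close> pulls back
  to a potential on \<open>Gs i\<close>.\<close>

lemma gdist_upd_le:
  assumes x: "x \<in> vertices P" and i: "i < m" "b \<in> vertices (Gs i)"
  shows "gdist P x (x(i := b)) \<le> gdist (Gs i) (x i) b"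
proof -
  interpret Gi: weighted_graph "Gs i" by (rule factor_graph[OF i(1)])
  have xi: "x i \<in> vertices (Gs i)"
    using x i by (auto simp: vertices_cart_prod)
  have xb: "x(i := b) \<in> vertices P"
    by (rule cart_prod_upd[OF x i])
  have "gdist P (x(i := b)) (x(i := x i)) \<le> gdist P (x(i := b)) (x(i := b)) + gdist (Gs i) (x i) b"
  proof (rule Gi.nn.potential_le_gdist[where h = "\<lambda>a. gdist P (x(i := b)) (x(i := a))", OF _ xi i(2)])
    fix a a' assume "{a, a'} \<in> edges (Gs i)"
    then show "gdist P (x(i := b)) (x(i := a)) \<le> gdist P (x(i := b)) (x(i := a')) + weight (Gs i) {a, a'}"
      using P.nn.gdist_edge_step[OF xb, of "x(i := a')" "x(i := a)"] upd_edge[OF x i(1)]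
      by (simp add: insert_commute)
  qed
  then show ?thesis
    using P.nn.gdist_self[OF xb] P.nn.gdist_sym[OF xb x] by simp
qed

text \<open>For the upper bound, the coordinates are changed one at a time through
  \<open>mix\<close>. For the lower bound, the sum of the coordinate distances is a potential,
  because a product edge moves a single coordinate.\<close>

lemma gdist_cart_prod:
  assumes x: "x \<in> vertices P" and y: "y \<in> vertices P"
  shows "gdist P x y = (\<Sum>i<m. gdist (Gs i) (x i) (y i))"
proof (rule antisym)
  have in_factor: "z i \<in> vertices (Gs i)" if "z \<in> vertices P" "i < m" for z i
    using that by (auto simp: vertices_cart_prod)
  have "gdist P x (mix k x y) \<le> (\<Sum>i<k. gdist (Gs i) (x i) (y i))" if "k \<le> m" for k
    using that
  proof (induction k)
    case 0
    then show ?case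
      using P.nn.gdist_self[OF x] by simp
  next
    case (Suc k)
    then have k: "k < m" by simp
    have z: "mix k x y \<in> vertices P" "mix (Suc k) x y \<in> vertices P"
      using Suc.prems by (auto intro!: mix_in[OF x y])
    have "gdist P (mix k x y) (mix (Suc k) x y) \<le> gdist (Gs k) (x k) (y k)"
      unfolding mix_Suc using gdist_upd_le[OF z(1) k in_factor[OF y k]] by simp
    then show ?case
      using Suc P.nn.gdist_triangle[OF x z] P.nn.gdist_sym[OF z] by simp
  qed
  from this[of m] show "gdist P x y \<le> (\<Sum>i<m. gdist (Gs i) (x i) (y i))"
    by (simp add: mix_all[OF x y])
  let ?h = "\<lambda>z. \<Sum>i<m. gdist (Gs i) (y i) (z i)"
  have "?h x \<le> ?h y + gdist P x y"
  proof (rule P.nn.potential_le_gdist[where h = ?h, OF _ x y])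
    fix z z' assume e: "{z, z'} \<in> edges P"
    then obtain l where l: "product_edge_at m Gs l z z'"
      and z: "z \<in> vertices P" "z' \<in> vertices P"
      using edges_cart_prod_iff by blast
    have w: "weight P {z, z'} = weight (Gs l) {z l, z' l}"
      by (rule product_edge_imp_edge(2)[OF z l])
    have "?h z \<le> (\<Sum>i<m. gdist (Gs i) (y i) (z' i) + (if i = l then weight P {z, z'} else 0))"
    proof (rule sum_mono)
      fix i assume "i \<in> {..<m}"
      then have i: "i < m" by simp
      interpret Gi: weighted_graph "Gs i" by (rule factor_graph[OF i])
      show "gdist (Gs i) (y i) (z i) \<le> gdist (Gs i) (y i) (z' i) + (if i = l then weight P {z, z'} else 0)"
        using l i w Gi.nn.gdist_edge_step[OF in_factor[OF y i], of "z' i" "z i"]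
        by (auto simp: product_edge_at_def insert_commute)
    qed
    also have "\<dots> = ?h z' + weight P {z, z'}"
      using l by (simp add: sum.distrib product_edge_at_def)
    finally show "?h z \<le> ?h z' + weight P {z, z'}" .
  qed
  moreover have "?h x = (\<Sum>i<m. gdist (Gs i) (x i) (y i))"
    using in_factor[OF x] in_factor[OF y]
    by (intro sum.cong refl weighted_graph.gdist_commute[OF factor_graph]) auto
  moreover have "?h y = 0"
    using in_factor[OF y]
    by (intro sum.neutral) (auto simp: weighted_graph.gdist_eq_0_iff[OF factor_graph])
  ultimately show "(\<Sum>i<m. gdist (Gs i) (x i) (y i)) \<le> gdist P x y"
    by simp
qed

end

section \<open>Splitting the distance along a colouring of the edges\<close>

definition colour_part :: "'a wgraph \<Rightarrow> ('a set \<Rightarrow> nat) \<Rightarrow> nat \<Rightarrow> 'a wgraph" where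
  "colour_part G c i = G\<lparr>weight := \<lambda>e. if c e = i then weight G e else 0\<rparr>"

lemma colour_part_simps [simp]:
  "vertices (colour_part G c i) = vertices G"
  "edges (colour_part G c i) = edges G"
  "weight (colour_part G c i) e = (if c e = i then weight G e else 0)"
  "gpath (colour_part G c i) = gpath G"
  by (auto simp: colour_part_def gpath_def fun_eq_iff)

text \<open>Edges \<open>uv\<close> and \<open>xy\<close> are in the Djokovic--Winkler relation iff this value is nonzero.\<close>

definition dw_diff :: "'a wgraph \<Rightarrow> 'a \<Rightarrow> 'a \<Rightarrow> 'a \<Rightarrow> 'a \<Rightarrow> real" where
  "dw_diff G u v x y = gdist G u x - gdist G u y - gdist G v x + gdist G v y"

text \<open>The potential that certifies that a shortest path has the least possible weight in
  colour \<open>i\<close> among all paths with the same ends.\<close>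

fun path_potential ::
    "'a wgraph \<Rightarrow> ('a set \<Rightarrow> nat) \<Rightarrow> nat \<Rightarrow> 'a list \<Rightarrow> 'a \<Rightarrow> real" where
  "path_potential G c i (s # t # p) a =
     (if c {s, t} = i then gdist G t a - gdist G s a else 0) + path_potential G c i (t # p) a"
| "path_potential G c i p a = 0"

context weighted_graph
begin

lemma nonneg_colour_part: "nonneg_wgraph (colour_part G c i)"
  using nn.fin nn.edge_vertices nn.nonneg nn.conn by unfold_locales auto

lemma sum_path_weight_colour_part:
  assumes "\<And>e. e \<in> edges G \<Longrightarrow> c e < m" and "successively (\<lambda>x y. {x, y} \<in> edges G) p"
  shows "(\<Sum>i<m. path_weight (colour_part G c i) p) = path_weight G p"
  using assms(2)
proof (induction p rule: induct_list012)
  case (3 x y zs)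
  then show ?case
    using assms(1)[of "{x, y}"] by (simp add: sum.distrib)
qed auto

text \<open>One shortest path of \<open>G\<close> competes in every colour, and its colour weights
  add up to its weight. This direction holds for any colouring; equality needs unrelated
  colours.\<close>

lemma sum_gdist_colour_part_le:
  assumes "\<And>e. e \<in> edges G \<Longrightarrow> c e < m" and uv: "u \<in> vertices G" "v \<in> vertices G"
  shows "(\<Sum>i<m. gdist (colour_part G c i) u v) \<le> gdist G u v"
proof -
  obtain p where p: "gpath G u p v" "gdist G u v = path_weight G p"
    using nn.gdist_attained[OF uv] by blast
  have "(\<Sum>i<m. gdist (colour_part G c i) u v) \<le> (\<Sum>i<m. path_weight (colour_part G c i) p)"
    using p(1) by (intro sum_mono nonneg_wgraph.gdist_le_path_weight[OF nonneg_colour_part]) simp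
  also have "\<dots> = gdist G u v"
    using sum_path_weight_colour_part[OF assms(1)] p by (auto simp: gpath_def)
  finally show ?thesis .
qed

text \<open>Along a shortest path from \<open>u\<close> to \<open>v\<close>, every edge increases the distance from \<open>u\<close> and
  decreases the distance to \<open>v\<close> by exactly its weight.\<close>

lemma path_potential_geodesic:
  assumes "u \<in> vertices G" "v \<in> vertices G"
    and "successively (\<lambda>x y. {x, y} \<in> edges G) p" "p \<noteq> []" "set p \<subseteq> vertices G" "last p = v"
    and "gdist G u v = gdist G u (hd p) + path_weight G p"
  shows "path_potential G c i p u - path_potential G c i p v
    = 2 * path_weight (colour_part G c i) p"
  using assms(3-)
proof (induction p rule: induct_list012)
  case (3 s t q)
  have e: "{s, t} \<in> edges G" and st: "s \<in> vertices G" "t \<in> vertices G"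
    using "3.prems" by auto
  have vs: "gdist G v s = gdist G s v" and vt: "gdist G v t = gdist G t v"
    using st assms(2) by (auto intro: gdist_commute)
  have "gdist G v x \<le> gdist G v y + weight G {x, y}" if "{x, y} \<in> edges G" for x y
    using nn.gdist_edge_step[OF assms(2), of y x] that by (simp add: insert_commute)
  then have "gdist G v (hd (t # q)) \<le> gdist G v (last (t # q)) + path_weight G (t # q)"
    using "3.prems" by (intro nn.potential_le_path_weight) auto
  then have tv: "gdist G t v \<le> path_weight G (t # q)"
    using "3.prems" vt by (simp add: nn.gdist_self[OF assms(2)])
  have "gdist G u t \<le> gdist G u s + weight G {s, t}"
    by (rule nn.gdist_edge_step[OF assms(1) e])
  moreover have "gdist G s v \<le> weight G {s, t} + gdist G t v"
    using nn.gdist_edge_step[OF assms(2), of t s] e by (simp add: vs vt insert_commute)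
  moreover have "gdist G u v \<le> gdist G u t + gdist G t v" "gdist G u v \<le> gdist G u s + gdist G s v"
    using nn.gdist_triangle[OF assms(1) st(2) assms(2)] nn.gdist_triangle[OF assms(1) st(1) assms(2)]
    by (simp_all add: vs vt)
  moreover have "gdist G u v = gdist G u s + (weight G {s, t} + path_weight G (t # q))"
    using "3.prems" by simp
  \<comment> \<open>The whole path is tight, so the chain of triangle inequalities through
    \<open>s\<close> and \<open>t\<close> collapses to equalities.\<close>
  ultimately have *: "gdist G u v = gdist G u t + path_weight G (t # q)"
    "gdist G u t - gdist G u s = weight G {s, t}" "gdist G s v - gdist G t v = weight G {s, t}"
    using tv by linarith+
  have "path_potential G c i (t # q) u - path_potential G c i (t # q) v
    = 2 * path_weight (colour_part G c i) (t # q)"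
    using "3.prems" *(1) by (intro "3.IH"(2)) auto
  then show ?case
    using *(2,3) gdist_commute[OF st(1) assms(1)] gdist_commute[OF st(2) assms(1)] by simp
qed auto

end

text \<open>The colour classes of \<open>c\<close> are unions of classes of the transitive closure of the
  Djokovic--Winkler relation.\<close>

locale dw_colouring = weighted_graph G for G :: "'a wgraph" +
  fixes c :: "'a set \<Rightarrow> nat" and m :: nat
  assumes minimal: "minimal_wgraph G"
    and colour_less: "e \<in> edges G \<Longrightarrow> c e < m"
    and dw_diff_0: "{u, v} \<in> edges G \<Longrightarrow> {x, y} \<in> edges G \<Longrightarrow> c {u, v} \<noteq> c {x, y} \<Longrightarrow>
      dw_diff G u v x y = 0"
begin

abbreviation D :: "nat \<Rightarrow> 'a \<Rightarrow> 'a \<Rightarrow> real" where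
  "D i \<equiv> gdist (colour_part G c i)"

sublocale cp: nonneg_wgraph "colour_part G c i" for i
  by (rule nonneg_colour_part)

section \<open>Colour weights of shortest paths\<close>

lemma weight_eq_gdist: "{u, v} \<in> edges G \<Longrightarrow> weight G {u, v} = gdist G u v"
  using minimal by (simp add: minimal_wgraph_def)

text \<open>Only the edges of \<open>p\<close> of colour \<open>i\<close> contribute, and for each
  of them the two contributions differ by a \<open>dw_diff\<close> that vanishes.\<close>

lemma path_potential_other_colour:
  assumes e: "{a, b} \<in> edges G" and "c {a, b} \<noteq> i"
    and "successively (\<lambda>x y. {x, y} \<in> edges G) p"
  shows "path_potential G c i p a = path_potential G c i p b"
  using assms(3)
proof (induction p rule: induct_list012)
  case (3 s t q)
  then show ?case
    using dw_diff_0[of s t a b] assms by (auto simp: dw_diff_def)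
qed auto

text \<open>The omitted edges of \<open>p\<close> have other colours, so including them would not
  change the difference. The sum over all edges then telescopes to the ends of
  \<open>p\<close>.\<close>

lemma path_potential_same_colour:
  assumes e: "{a, b} \<in> edges G" and "c {a, b} = i"
    and "successively (\<lambda>x y. {x, y} \<in> edges G) p" "p \<noteq> []"
  shows "path_potential G c i p a - path_potential G c i p b
    = gdist G (last p) a - gdist G (hd p) a - gdist G (last p) b + gdist G (hd p) b"
  using assms(3,4)
proof (induction p rule: induct_list012)
  case (3 s t q)
  then show ?case
    using dw_diff_0[of s t a b] assms by (auto simp: dw_diff_def)
qed auto

text \<open>Across an edge of colour \<open>i\<close> the potential depends only on the distances to
  the two ends of \<open>p\<close>, and each of these changes by at most the weight; across other
  edges it is constant.\<close>

lemma path_weight_colour_part_le: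
  assumes p: "gpath G u p v" "gdist G u v = path_weight G p"
  shows "path_weight (colour_part G c i) p \<le> D i u v"
proof -
  have uv: "u \<in> vertices G" "v \<in> vertices G"
    and succ: "successively (\<lambda>x y. {x, y} \<in> edges G) p" "p \<noteq> []"
    and ends: "hd p = u" "last p = v" "set p \<subseteq> vertices G"
    using p(1) by (auto simp: gpath_def)
  \<comment> \<open>Halving compensates for the factor 2 in \<open>path_potential_geodesic\<close>,
    where every edge is counted once from each end of \<open>p\<close>.\<close>
  let ?h = "\<lambda>a. path_potential G c i p a / 2"
  have "?h u \<le> ?h v + D i u v"
  proof (rule cp.potential_le_gdist[where h = ?h])
    fix a b assume "{a, b} \<in> edges (colour_part G c i)"
    then have e: "{a, b} \<in> edges G" by simp
    show "?h a \<le> ?h b + weight (colour_part G c i) {a, b}"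
    proof (cases "c {a, b} = i")
      case True
      have "gdist G v a \<le> gdist G v b + weight G {a, b}"
        using nn.gdist_edge_step[OF uv(2), of b a] e by (simp add: insert_commute)
      moreover have "gdist G u b \<le> gdist G u a + weight G {a, b}"
        using nn.gdist_edge_step[OF uv(1) e] .
      ultimately show ?thesis
        using path_potential_same_colour[OF e True succ] by (simp add: True ends field_simps)
    next
      case False
      then show ?thesis
        using path_potential_other_colour[OF e False succ(1)] by simp
    qed
  qed (use uv in auto)
  then show ?thesis
    using path_potential_geodesic[OF uv succ ends(3,2), of c i] p ends uv
    by (simp add: nn.gdist_self)
qed

lemma sum_gdist_colour_part:
  assumes uv: "u \<in> vertices G" "v \<in> vertices G"
  shows "(\<Sum>i<m. D i u v) = gdist G u v"
proof (rule antisym)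
  show "(\<Sum>i<m. D i u v) \<le> gdist G u v"
    using colour_less uv by (rule sum_gdist_colour_part_le)
  obtain p where p: "gpath G u p v" "gdist G u v = path_weight G p"
    using nn.gdist_attained[OF uv] by blast
  then have "gdist G u v = (\<Sum>i<m. path_weight (colour_part G c i) p)"
    using sum_path_weight_colour_part[OF colour_less] by (simp add: gpath_def)
  also have "\<dots> \<le> (\<Sum>i<m. D i u v)"
    by (intro sum_mono path_weight_colour_part_le[OF p])
  finally show "gdist G u v \<le> (\<Sum>i<m. D i u v)" .
qed

text \<open>By minimality the weight is the distance, hence the sum of the \<open>D j\<close>.
  Colours other than that of the edge contribute 0, so its own colour must carry the full
  weight.\<close>

lemma D_edge:
  assumes e: "{u, v} \<in> edges G"
  shows "D i u v = (if c {u, v} = i then weight G {u, v} else 0)"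
proof -
  have le: "D j u v \<le> (if c {u, v} = j then weight G {u, v} else 0)" for j
    using cp.gdist_edge_le[of u v j] e by simp
  have ge: "0 \<le> D j u v" for j
    using cp.gdist_nonneg[of u j v] edge_ends[OF e] by simp
  show ?thesis
  proof (cases "c {u, v} = i")
    case True
    have le_i: "D j u v \<le> (if j = i then D i u v else 0)" for j
      using le[of j] True by auto
    have "weight G {u, v} = (\<Sum>j<m. D j u v)"
      using sum_gdist_colour_part edge_ends[OF e] weight_eq_gdist[OF e] by simp
    also have "\<dots> \<le> (\<Sum>j<m. if j = i then D i u v else 0)"
      by (rule sum_mono) (rule le_i)
    also have "\<dots> = D i u v"
      using colour_less[OF e] True by simp
    finally show ?thesis
      using le[of i] True by simp
  next
    case False
    then show ?thesis
      using le[of i] ge[of i] by simp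
  qed
qed

text \<open>The factor of colour \<open>i\<close> contracts all edges of the other colours; each contracted
  component is represented by one of its vertices, and \<open>Max\<close> extracts the distance of the
  two ends of an edge.\<close>

definition rep :: "nat \<Rightarrow> 'a \<Rightarrow> 'a" where
  "rep i u = (SOME v. v \<in> vertices G \<and> D i u v = 0)"

definition factor :: "nat \<Rightarrow> 'a wgraph" where
  "factor i = \<lparr> vertices = rep i ` vertices G,
     edges = (`) (rep i) ` {e \<in> edges G. c e = i},
     weight = (\<lambda>e. Max ((\<lambda>(x, y). D i x y) ` (e \<times> e))) \<rparr>"

section \<open>Contracting the edges of other colours\<close>

lemma rep:
  assumes "u \<in> vertices G"
  shows "rep i u \<in> vertices G" "D i u (rep i u) = 0"
proof -
  have "u \<in> vertices G \<and> D i u u = 0"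
    using assms by (simp add: cp.gdist_self)
  then have "rep i u \<in> vertices G \<and> D i u (rep i u) = 0"
    unfolding rep_def by (rule someI)
  then show "rep i u \<in> vertices G" "D i u (rep i u) = 0"
    by auto
qed

lemma D_rep:
  assumes "u \<in> vertices G" "v \<in> vertices G"
  shows "D i (rep i u) (rep i v) = D i u v"
  using cp.gdist_eq_0_cong[of u i "rep i u" "rep i v"] cp.gdist_eq_0_cong[of v i "rep i v" u]
    rep[OF assms(1), of i] rep[OF assms(2), of i] assms by simp

text \<open>Vertices at distance 0 have the same candidates for a representative, so
  \<open>SOME\<close> makes the same choice for both.\<close>

lemma rep_eq_iff:
  assumes "u \<in> vertices G" "v \<in> vertices G"
  shows "rep i u = rep i v \<longleftrightarrow> D i u v = 0"
proof
  assume "rep i u = rep i v"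
  then show "D i u v = 0"
    using D_rep[OF assms, of i] rep[OF assms(2), of i] by (simp add: cp.gdist_self)
next
  assume "D i u v = 0"
  then have "z \<in> vertices G \<and> D i u z = 0 \<longleftrightarrow> z \<in> vertices G \<and> D i v z = 0" for z
    using cp.gdist_eq_0_cong(1)[of u i v z] assms by auto
  then show "rep i u = rep i v"
    unfolding rep_def by simp
qed

lemma factor_edge:
  assumes e: "{u, v} \<in> edges G" and "c {u, v} = i"
  shows "{rep i u, rep i v} \<in> edges (factor i)" "rep i u \<noteq> rep i v"
    "weight (factor i) {rep i u, rep i v} = weight G {u, v}"
proof -
  have "{u, v} \<in> {e \<in> edges G. c e = i}"
    using assms by simp
  from imageI[OF this, of "(`) (rep i)"] show "{rep i u, rep i v} \<in> edges (factor i)"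
    by (simp add: factor_def)
  have uv: "u \<in> vertices G" "v \<in> vertices G" and w: "0 < weight G {u, v}"
    using edge_ends[OF e] weight_pos[OF e] by auto
  show "rep i u \<noteq> rep i v"
    using rep_eq_iff[OF uv] D_edge[OF e] assms(2) w by simp
  have "D i v u = D i u v"
    using cp.gdist_sym uv by simp
  then show "weight (factor i) {rep i u, rep i v} = weight G {u, v}"
    using D_edge[OF e, of i] assms(2) w uv
    by (simp add: factor_def insert_Times_insert D_rep cp.gdist_self)
qed

lemma factor_edgeE:
  assumes "e \<in> edges (factor i)"
  obtains u v where "e = {rep i u, rep i v}" "{u, v} \<in> edges G" "c {u, v} = i"
    "u \<in> vertices G" "v \<in> vertices G"
proof -
  obtain d where d: "d \<in> edges G" "c d = i" "e = rep i ` d"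
    using assms by (auto simp: factor_def)
  obtain u v where "d = {u, v}" "{u, v} \<in> edges G" "u \<in> vertices G" "v \<in> vertices G"
    using edgeE[OF d(1)] by blast
  then show thesis
    using that[of u v] d by simp
qed

lemma factor_vertices: "vertices (factor i) = rep i ` vertices G"
  by (simp add: factor_def)

lemma weighted_graph_factor: "weighted_graph (factor i)"
proof
  show "finite (vertices (factor i))" "vertices (factor i) \<noteq> {}"
    using finite_vertices vertices_nonempty by (auto simp: factor_vertices)
next
  fix e assume "e \<in> edges (factor i)"
  then obtain u v where uv: "e = {rep i u, rep i v}" "{u, v} \<in> edges G" "c {u, v} = i"
    "u \<in> vertices G" "v \<in> vertices G"
    by (rule factor_edgeE)
  then show "e \<subseteq> vertices (factor i)" "card e = 2" "0 < weight (factor i) e"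
    using factor_edge[OF uv(2,3)] weight_pos[OF uv(2)] by (auto simp: factor_vertices)
next
  fix x y assume "x \<in> vertices (factor i)" "y \<in> vertices (factor i)"
  then obtain u v where uv: "u \<in> vertices G" "v \<in> vertices G" "x = rep i u" "y = rep i v"
    by (auto simp: factor_vertices)
  have nonneg: "0 \<le> weight (factor i) e" if "e \<in> edges (factor i)" for e
    using that
  proof (rule factor_edgeE)
    fix a b assume "e = {rep i a, rep i b}" "{a, b} \<in> edges G" "c {a, b} = i"
    then show "0 \<le> weight (factor i) e"
      using factor_edge(3)[of a b i] weight_pos[of "{a, b}"] by simp
  qed
  \<comment> \<open>A path of \<open>G\<close> is projected by \<open>rep i\<close>: edges of colour
    \<open>i\<close> become edges and all others collapse to a point.\<close>
  have "\<exists>p. gpath (factor i) (rep i u) p (rep i v)"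
  proof (rule nn.connected_induct[OF uv(1,2), where P = "\<lambda>z. \<exists>p. gpath (factor i) (rep i u) p (rep i z)"])
    show "\<exists>p. gpath (factor i) (rep i u) p (rep i u)"
      using gpath_refl[of "rep i u" "factor i"] uv(1) by (auto simp: factor_vertices)
  next
    fix a b assume e: "{a, b} \<in> edges G" and "\<exists>p. gpath (factor i) (rep i u) p (rep i a)"
    then obtain p where p: "gpath (factor i) (rep i u) p (rep i a)"
      by blast
    have ab: "a \<in> vertices G" "b \<in> vertices G"
      using edge_ends[OF e] by auto
    show "\<exists>p. gpath (factor i) (rep i u) p (rep i b)"
    proof (cases "c {a, b} = i")
      case True
      then show ?thesis
        using gpath_extend[OF nonneg p factor_edge(1)[OF e True]] ab by (auto simp: factor_vertices)
    next
      case False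
      then have "rep i a = rep i b"
        using D_edge[OF e] rep_eq_iff[OF ab] by simp
      then show ?thesis
        using p by auto
    qed
  qed
  then show "\<exists>p. gpath (factor i) x p y"
    by (simp add: uv)
qed

sublocale fac: weighted_graph "factor i" for i
  by (rule weighted_graph_factor)

text \<open>Each distance gives a potential for the other: the factor distance pulled back along
  \<open>rep i\<close> on the colour part, and \<open>D i\<close> on the factor.\<close>

lemma gdist_factor:
  assumes uv: "u \<in> vertices G" "v \<in> vertices G"
  shows "gdist (factor i) (rep i u) (rep i v) = D i u v"
proof (rule antisym)
  have rv: "rep i v \<in> vertices (factor i)" "rep i u \<in> vertices (factor i)"
    using uv by (auto simp: factor_vertices)
  have "gdist (factor i) (rep i v) (rep i u) \<le> gdist (factor i) (rep i v) (rep i v) + D i u v"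
  proof (rule cp.potential_le_gdist[where h = "\<lambda>z. gdist (factor i) (rep i v) (rep i z)"])
    fix a b assume "{a, b} \<in> edges (colour_part G c i)"
    then have e: "{a, b} \<in> edges G" by simp
    show "gdist (factor i) (rep i v) (rep i a)
      \<le> gdist (factor i) (rep i v) (rep i b) + weight (colour_part G c i) {a, b}"
    proof (cases "c {a, b} = i")
      case True
      then show ?thesis
        using fac.nn.gdist_edge_step[OF rv(1), of "rep i b" "rep i a"] factor_edge[OF e True]
        by (simp add: insert_commute)
    next
      case False
      then show ?thesis
        using D_edge[OF e, of i] rep_eq_iff[of a b i] edge_ends[OF e] by simp
    qed
  qed (use uv in auto)
  then show "gdist (factor i) (rep i u) (rep i v) \<le> D i u v"
    using fac.nn.gdist_self rv fac.gdist_commute by simp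
  have rr: "rep i u \<in> vertices G" "rep i v \<in> vertices G"
    using rep uv by auto
  have "D i (rep i v) (rep i u) \<le> D i (rep i v) (rep i v) + gdist (factor i) (rep i u) (rep i v)"
  proof (rule fac.nn.potential_le_gdist[where h = "D i (rep i v)", OF _ rv(2,1)])
    fix x y assume "{x, y} \<in> edges (factor i)"
    then obtain a b where ab: "{x, y} = {rep i a, rep i b}" "{a, b} \<in> edges G" "c {a, b} = i"
      "a \<in> vertices G" "b \<in> vertices G"
      by (rule factor_edgeE)
    have "D i (rep i a) (rep i b) = weight (factor i) {x, y}"
      using D_rep ab D_edge[OF ab(2)] factor_edge(3)[OF ab(2,3)] by simp
    moreover have "x = rep i a \<and> y = rep i b \<or> x = rep i b \<and> y = rep i a"
      using ab(1) by (auto simp: doubleton_eq_iff)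
    ultimately show "D i (rep i v) x \<le> D i (rep i v) y + weight (factor i) {x, y}"
      using cp.gdist_triangle[of "rep i v" i y x] cp.gdist_sym[of "rep i a" i "rep i b"] rr rep ab(4,5)
      by auto
  qed
  then show "D i u v \<le> gdist (factor i) (rep i u) (rep i v)"
    using D_rep[OF uv] cp.gdist_self cp.gdist_sym rr by simp
qed

text \<open>Isometry is \<open>sum_gdist_colour_part\<close> combined with the additivity of product
  distances. That every colour is used keeps \<open>K1\<close> out of the family.\<close>

lemma pseudofactorization_factor:
  assumes "1 \<le> m" and used: "\<And>i. i < m \<Longrightarrow> \<exists>e\<in>edges G. c e = i"
  shows "pseudofactorization m factor G"
proof -
  interpret F: graph_family m factor
    by unfold_locales
  define \<pi> where "\<pi> u = (\<lambda>i\<in>{..<m}. rep i u)" for u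
  have \<pi>_in: "\<pi> u \<in> vertices F.P" if "u \<in> vertices G" for u
    using that by (auto simp: vertices_cart_prod \<pi>_def factor_vertices)
  have \<pi>_nth: "\<pi> u i = rep i u" if "i < m" for u i
    using that by (simp add: \<pi>_def)
  have other: "rep i u = rep i v" if "{u, v} \<in> edges G" "c {u, v} \<noteq> i" for u v i
    using rep_eq_iff[of u v i] D_edge[OF that(1), of i] edge_ends[OF that(1)] that(2) by simp
  have "pseudofactor_map \<pi> m factor G"
    unfolding pseudofactor_map_def
  proof (intro conjI ballI allI impI)
    show "\<pi> ` vertices G \<subseteq> vertices F.P"
      using \<pi>_in by blast
  next
    fix u v assume uv: "u \<in> vertices G" "v \<in> vertices G"
    show "gdist G u v = gdist F.P (\<pi> u) (\<pi> v)"
      unfolding F.gdist_cart_prod[OF \<pi>_in[OF uv(1)] \<pi>_in[OF uv(2)]]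
        sum_gdist_colour_part[OF uv, symmetric]
      by (intro sum.cong refl) (simp add: \<pi>_nth gdist_factor uv)
  next
    fix u v assume e: "{u, v} \<in> edges G"
    have uv: "\<pi> u \<in> vertices F.P" "\<pi> v \<in> vertices F.P"
      using edge_ends[OF e] \<pi>_in by auto
    have "product_edge_at m factor (c {u, v}) (\<pi> u) (\<pi> v)"
      unfolding product_edge_at_def
      using colour_less[OF e] factor_edge(1)[OF e refl] other[OF e] by (simp add: \<pi>_nth)
    from F.product_edge_imp_edge[OF uv this]
    show "{\<pi> u, \<pi> v} \<in> edges F.P" "weight G {u, v} = weight F.P {\<pi> u, \<pi> v}"
      using colour_less[OF e] factor_edge(3)[OF e refl] by (simp_all add: \<pi>_nth)
  next
    fix i x assume "i < m" "x \<in> vertices (factor i)"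
    then show "\<exists>u\<in>vertices G. \<pi> u i = x"
      by (auto simp: factor_vertices \<pi>_nth)
  next
    fix i e assume i: "i < m" and "e \<in> edges (factor i)"
    then obtain u v where uv: "e = {rep i u, rep i v}" "{u, v} \<in> edges G" "c {u, v} = i"
      by (metis factor_edgeE)
    have "(THE l. l < m \<and> \<pi> u l \<noteq> \<pi> v l) = i"
    proof (rule the_equality)
      show "i < m \<and> \<pi> u i \<noteq> \<pi> v i"
        using i factor_edge(2)[OF uv(2,3)] by (simp add: \<pi>_nth)
      show "l = i" if "l < m \<and> \<pi> u l \<noteq> \<pi> v l" for l
        using other[OF uv(2), of l] uv(3) that by (cases "l = i") (auto simp: \<pi>_nth)
    qed
    then show "\<exists>u v. {u, v} \<in> edges G \<and> parent_edge m \<pi> u v = (i, e)"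
      using uv i by (intro exI[of _ u] exI[of _ v]) (simp add: parent_edge_def \<pi>_nth)
  qed
  moreover have "\<not> one_vertex (factor i)" if "i < m" for i
  proof -
    obtain e where "e \<in> edges G" "c e = i"
      using used[OF \<open>i < m\<close>] by blast
    then have "rep i ` e \<in> edges (factor i)"
      by (auto simp: factor_def)
    then show ?thesis
      by (rule fac.edge_not_one_vertex)
  qed
  ultimately show ?thesis
    using assms(1) weighted_graph_factor unfolding pseudofactorization_def by blast
qed

end

section \<open>Irreducibility by counting edges\<close>

lemma edges_iso_card_le:
  assumes "weighted_graph H" "wgraph_iso_map f G H" "weighted_graph G"
  shows "card (edges H) \<le> card (edges G)"
proof (rule surj_card_le)
  show "finite (edges G)"
    by (rule weighted_graph.finite_edges[OF assms(3)])
  show "edges H \<subseteq> (`) f ` edges G"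
  proof
    fix e assume "e \<in> edges H"
    then obtain a b where ab: "e = {a, b}" "{a, b} \<in> edges H" "a \<in> vertices H" "b \<in> vertices H"
      using weighted_graph.edgeE[OF assms(1)] by blast
    then have "a \<in> f ` vertices G" "b \<in> f ` vertices G"
      using assms(2) by (auto simp: wgraph_iso_map_def bij_betw_def)
    then obtain u v where uv: "u \<in> vertices G" "v \<in> vertices G" "a = f u" "b = f v"
      by blast
    then have "{u, v} \<in> edges G"
      using assms(2) ab(2) by (simp add: wgraph_iso_map_def)
    then show "e \<in> (`) f ` edges G"
      using uv ab(1) by (auto intro!: image_eqI[of _ _ "{u, v}"])
  qed
qed

text \<open>A factor has at most as many edges as its colour class, which misses an edge of another
  colour. Taking representatives in \<open>G\<close> as vertices gives the factors the vertex type
  that \<open>irreducible_wgraph\<close> demands.\<close>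

lemma (in dw_colouring) not_irreducible:
  assumes m: "2 \<le> m" and used: "\<And>i. i < m \<Longrightarrow> \<exists>e\<in>edges G. c e = i"
  shows "\<not> irreducible_wgraph G"
proof
  assume "irreducible_wgraph G"
  moreover have "pseudofactorization m factor G"
    using m used by (intro pseudofactorization_factor) auto
  ultimately obtain i where i: "i < m" "wgraph_isomorphic (factor i) G"
    unfolding irreducible_wgraph_def by blast
  then have "card (edges G) \<le> card (edges (factor i))"
    using edges_iso_card_le[OF weighted_graph_axioms _ weighted_graph_factor]
    by (auto simp: wgraph_isomorphic_def)
  also have "\<dots> \<le> card {e \<in> edges G. c e = i}"
    using finite_edges by (simp add: factor_def card_image_le)
  also have "\<dots> < card (edges G)"
  proof (rule psubset_card_mono[OF finite_edges])
    obtain j where "j < m" "j \<noteq> i"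
      using m that[of 0] that[of 1] by (cases "i = 0") auto
    then show "{e \<in> edges G. c e = i} \<subset> edges G"
      using used[of j] by auto
  qed
  finally show False
    by simp
qed

section \<open>The edge colouring of a pseudofactorization\<close>

locale pseudofactors = weighted_graph G + graph_family m Gs
  for G :: "'a wgraph" and m :: nat and Gs :: "nat \<Rightarrow> 'b wgraph" +
  fixes \<pi> :: "'a \<Rightarrow> nat \<Rightarrow> 'b"
  assumes minimal: "minimal_wgraph G"
    and pf_map: "pseudofactor_map \<pi> m Gs G"
begin

text \<open>Non-edges get the colour \<open>m\<close>, which is not the index of a factor.\<close>

definition col :: "'a set \<Rightarrow> nat" where
  "col e = (if e \<in> edges G
     then THE i. \<exists>u v. e = {u, v} \<and> product_edge_at m Gs i (\<pi> u) (\<pi> v) else m)"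

lemma \<pi>_in: "u \<in> vertices G \<Longrightarrow> \<pi> u \<in> vertices P"
  using pf_map by (auto simp: pseudofactor_map_def)

lemma \<pi>_nth: "u \<in> vertices G \<Longrightarrow> i < m \<Longrightarrow> \<pi> u i \<in> vertices (Gs i)"
  using \<pi>_in by (auto simp: vertices_cart_prod)

lemma vertices_factor: "i < m \<Longrightarrow> vertices (Gs i) = (\<lambda>u. \<pi> u i) ` vertices G"
  using \<pi>_nth pf_map by (fastforce simp: pseudofactor_map_def)

lemma gdist_sum:
  assumes "u \<in> vertices G" "v \<in> vertices G"
  shows "gdist G u v = (\<Sum>i<m. gdist (Gs i) (\<pi> u i) (\<pi> v i))"
  using pf_map assms gdist_cart_prod[OF \<pi>_in \<pi>_in] by (simp add: pseudofactor_map_def)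

lemma product_edge_col:
  assumes e: "{u, v} \<in> edges G"
  shows "product_edge_at m Gs (col {u, v}) (\<pi> u) (\<pi> v)"
proof -
  have "{\<pi> u, \<pi> v} \<in> edges P"
    using pf_map e by (auto simp: pseudofactor_map_def)
  then obtain i where i: "product_edge_at m Gs i (\<pi> u) (\<pi> v)"
    unfolding edges_cart_prod_iff by blast
  have "col {u, v} = i"
    unfolding col_def if_P[OF e]
  proof (rule the_equality)
    fix j assume "\<exists>u' v'. {u, v} = {u', v'} \<and> product_edge_at m Gs j (\<pi> u') (\<pi> v')"
    then have "product_edge_at m Gs j (\<pi> u) (\<pi> v)"
      using product_edge_at_commute by (metis doubleton_eq_iff)
    then show "j = i"
      using product_edge_at_unique[where m = m and Gs = Gs] factor_graph i by blast
  qed (use i in blast)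
  then show ?thesis
    using i by simp
qed

lemma col_edge:
  assumes e: "{u, v} \<in> edges G" and i: "col {u, v} = i"
  shows "i < m" "{\<pi> u i, \<pi> v i} \<in> edges (Gs i)" "\<pi> u i \<noteq> \<pi> v i"
    "weight (Gs i) {\<pi> u i, \<pi> v i} = weight G {u, v}"
    "\<And>j. j < m \<Longrightarrow> j \<noteq> i \<Longrightarrow> \<pi> u j = \<pi> v j"
proof -
  have p: "product_edge_at m Gs i (\<pi> u) (\<pi> v)"
    using product_edge_col[OF e] i by simp
  then show im: "i < m" and e': "{\<pi> u i, \<pi> v i} \<in> edges (Gs i)"
    and "\<And>j. j < m \<Longrightarrow> j \<noteq> i \<Longrightarrow> \<pi> u j = \<pi> v j"
    by (auto simp: product_edge_at_def)
  show "\<pi> u i \<noteq> \<pi> v i"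
    by (rule weighted_graph.edge_ends(3)[OF factor_graph[OF im] e'])
  have "weight G {u, v} = weight P {\<pi> u, \<pi> v}"
    using pf_map e by (auto simp: pseudofactor_map_def)
  then show "weight (Gs i) {\<pi> u i, \<pi> v i} = weight G {u, v}"
    using product_edge_imp_edge(2)[OF _ _ p] \<pi>_in edge_ends[OF e] by simp
qed

lemma col_less: "e \<in> edges G \<Longrightarrow> col e < m"
  using col_edge(1) by (metis edgeE)

lemma factor_edge_parent:
  assumes i: "i < m" and "e \<in> edges (Gs i)"
  obtains u v where "{u, v} \<in> edges G" "col {u, v} = i" "e = {\<pi> u i, \<pi> v i}"
    "u \<in> vertices G" "v \<in> vertices G"
proof -
  obtain u v where uv: "{u, v} \<in> edges G" "parent_edge m \<pi> u v = (i, e)"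
    using pf_map assms unfolding pseudofactor_map_def by blast
  have "(THE l. l < m \<and> \<pi> u l \<noteq> \<pi> v l) = col {u, v}"
    using col_edge[OF uv(1) refl] by (intro the_equality) auto
  then have "col {u, v} = i" "e = {\<pi> u i, \<pi> v i}"
    using uv(2) unfolding parent_edge_def Let_def by auto
  then show thesis
    using that[OF uv(1)] edge_ends[OF uv(1)] by simp
qed

text \<open>The weight is the distance in \<open>G\<close>, which is the sum of the coordinate
  distances, and only coordinate \<open>i\<close> differs along the edge.\<close>

lemma gdist_factor_edge:
  assumes e: "{u, v} \<in> edges G" and i: "col {u, v} = i"
  shows "gdist (Gs i) (\<pi> u i) (\<pi> v i) = weight G {u, v}"
proof -
  have uv: "u \<in> vertices G" "v \<in> vertices G"
    using edge_ends[OF e] by auto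
  have "weight G {u, v} = (\<Sum>j<m. gdist (Gs j) (\<pi> u j) (\<pi> v j))"
    using minimal e gdist_sum[OF uv] by (simp add: minimal_wgraph_def)
  also have "\<dots> = (\<Sum>j<m. if j = i then gdist (Gs i) (\<pi> u i) (\<pi> v i) else 0)"
  proof (intro sum.cong refl)
    fix j assume "j \<in> {..<m}"
    then show "gdist (Gs j) (\<pi> u j) (\<pi> v j) = (if j = i then gdist (Gs i) (\<pi> u i) (\<pi> v i) else 0)"
      using col_edge(5)[OF e i, of j] weighted_graph.gdist_eq_0_iff[OF factor_graph] \<pi>_nth uv by simp
  qed
  also have "\<dots> = gdist (Gs i) (\<pi> u i) (\<pi> v i)"
    using col_edge(1)[OF e i] by simp
  finally show ?thesis ..
qed

text \<open>This lets \<open>dw_colouring\<close> be applied to a pseudofactor in place of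
  \<open>G\<close>.\<close>

lemma minimal_factor:
  assumes i: "i < m"
  shows "minimal_wgraph (Gs i)"
  unfolding minimal_wgraph_def
proof (intro allI impI)
  fix a b assume ab: "{a, b} \<in> edges (Gs i)"
  then obtain u v where uv: "{u, v} \<in> edges G" "col {u, v} = i" "{a, b} = {\<pi> u i, \<pi> v i}"
    by (metis factor_edge_parent[OF i])
  have "gdist (Gs i) (\<pi> v i) (\<pi> u i) = gdist (Gs i) (\<pi> u i) (\<pi> v i)"
    using weighted_graph.gdist_commute[OF factor_graph[OF i]] \<pi>_nth[OF _ i] edge_ends[OF uv(1)]
    by simp
  moreover have "a = \<pi> u i \<and> b = \<pi> v i \<or> a = \<pi> v i \<and> b = \<pi> u i"
    using uv(3) by (auto simp: doubleton_eq_iff)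
  ultimately show "weight (Gs i) {a, b} = gdist (Gs i) a b"
    using gdist_factor_edge[OF uv(1,2)] col_edge(4)[OF uv(1,2)] uv(3) by auto
qed

text \<open>The relation splits over the coordinates, and a coordinate in which \<open>u\<close> and
  \<open>v\<close> agree contributes 0.\<close>

lemma dw_diff_factor:
  assumes e: "{u, v} \<in> edges G" "col {u, v} = i" and xy: "x \<in> vertices G" "y \<in> vertices G"
  shows "dw_diff G u v x y = dw_diff (Gs i) (\<pi> u i) (\<pi> v i) (\<pi> x i) (\<pi> y i)"
proof -
  have "dw_diff G u v x y = (\<Sum>j<m. dw_diff (Gs j) (\<pi> u j) (\<pi> v j) (\<pi> x j) (\<pi> y j))"
    using gdist_sum edge_ends[OF e(1)] xy
    by (simp add: dw_diff_def sum.distrib sum_subtractf)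
  also have "\<dots> = (\<Sum>j<m. if j = i then dw_diff (Gs i) (\<pi> u i) (\<pi> v i) (\<pi> x i) (\<pi> y i) else 0)"
    using col_edge(5)[OF e] by (intro sum.cong refl) (auto simp: dw_diff_def)
  also have "\<dots> = dw_diff (Gs i) (\<pi> u i) (\<pi> v i) (\<pi> x i) (\<pi> y i)"
    using col_edge(1)[OF e] by simp
  finally show ?thesis .
qed

text \<open>The edge \<open>xy\<close> leaves the one relevant coordinate unchanged.\<close>

lemma dw_diff_eq_0:
  assumes "{u, v} \<in> edges G" "{x, y} \<in> edges G" "col {u, v} \<noteq> col {x, y}"
  shows "dw_diff G u v x y = 0"
  using dw_diff_factor[OF assms(1) refl] col_edge(5)[OF assms(2) refl] col_edge(1)[OF assms(1) refl]
    edge_ends[OF assms(2)] assms(3) by (simp add: dw_diff_def)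

text \<open>The factor distance is a potential on the colour part, which gives one inequality per
  colour. Both sums lie between \<open>gdist G u v\<close> and itself, so every inequality is an
  equality.\<close>

lemma gdist_factor_eq:
  assumes uv: "u \<in> vertices G" "v \<in> vertices G" and i: "i < m"
  shows "gdist (Gs i) (\<pi> u i) (\<pi> v i) = gdist (colour_part G col i) u v"
proof -
  have le: "gdist (Gs j) (\<pi> u j) (\<pi> v j) \<le> gdist (colour_part G col j) u v" if j: "j < m" for j
  proof -
    interpret Gj: weighted_graph "Gs j" by (rule factor_graph[OF j])
    interpret C: nonneg_wgraph "colour_part G col j" by (rule nonneg_colour_part)
    have v: "\<pi> v j \<in> vertices (Gs j)" and u: "\<pi> u j \<in> vertices (Gs j)"
      using \<pi>_nth uv j by auto
    have "gdist (Gs j) (\<pi> v j) (\<pi> u j)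
      \<le> gdist (Gs j) (\<pi> v j) (\<pi> v j) + gdist (colour_part G col j) u v"
    proof (rule C.potential_le_gdist[where h = "\<lambda>z. gdist (Gs j) (\<pi> v j) (\<pi> z j)"])
      fix x y assume "{x, y} \<in> edges (colour_part G col j)"
      then have e: "{x, y} \<in> edges G" by simp
      show "gdist (Gs j) (\<pi> v j) (\<pi> x j)
        \<le> gdist (Gs j) (\<pi> v j) (\<pi> y j) + weight (colour_part G col j) {x, y}"
      proof (cases "col {x, y} = j")
        case True
        then show ?thesis
          using Gj.nn.gdist_edge_step[OF v, of "\<pi> y j" "\<pi> x j"] col_edge(2,4)[OF e True]
          by (simp add: insert_commute)
      next
        case False
        then show ?thesis
          using col_edge(5)[OF e refl j] by simp
      qed
    qed (use uv in auto)
    then show ?thesis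
      using Gj.nn.gdist_self[OF v] Gj.gdist_commute[OF u v] by simp
  qed
  have "(\<Sum>j<m. gdist (Gs j) (\<pi> u j) (\<pi> v j)) \<le> (\<Sum>j<m. gdist (colour_part G col j) u v)"
    using le by (intro sum_mono) simp
  moreover have "(\<Sum>j<m. gdist (colour_part G col j) u v) \<le> gdist G u v"
    using col_less uv by (rule sum_gdist_colour_part_le)
  ultimately have "(\<Sum>j<m. gdist (Gs j) (\<pi> u j) (\<pi> v j)) = (\<Sum>j<m. gdist (colour_part G col j) u v)"
    using gdist_sum[OF uv] by simp
  then show ?thesis
    by (rule sum_mono_inv) (use le i in auto)
qed

end

section \<open>Comparing two pseudofactorizations\<close>

locale two_pseudofactorizations =
  A: pseudofactors G m Gs \<pi> + B: pseudofactors G n Hs \<rho>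
  for G :: "'a wgraph" and m and Gs :: "nat \<Rightarrow> 'b wgraph" and \<pi> and n
    and Hs :: "nat \<Rightarrow> 'c wgraph" and \<rho>
begin

text \<open>Coordinates agree iff their factor distance is 0, and that distance depends on the
  colour class only.\<close>

lemma same_class_coords:
  assumes "i < m" "j < n" and col: "\<And>e. A.col e = i \<longleftrightarrow> B.col e = j"
    and uv: "u \<in> vertices G" "v \<in> vertices G"
  shows "\<pi> u i = \<pi> v i \<longleftrightarrow> \<rho> u j = \<rho> v j"
proof -
  \<comment> \<open>Equality of the records needs the classes to agree on all sets, not only on
    edges; hence the form of the hypothesis and the extra colour of non-edges.\<close>
  have "colour_part G A.col i = colour_part G B.col j"
    by (simp add: colour_part_def col)
  then have "gdist (Gs i) (\<pi> u i) (\<pi> v i) = gdist (Hs j) (\<rho> u j) (\<rho> v j)"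
    using A.gdist_factor_eq[OF uv assms(1)] B.gdist_factor_eq[OF uv assms(2)] by simp
  then show ?thesis
    using weighted_graph.gdist_eq_0_iff[OF A.factor_graph[OF assms(1)], of "\<pi> u i" "\<pi> v i"]
      weighted_graph.gdist_eq_0_iff[OF B.factor_graph[OF assms(2)], of "\<rho> u j" "\<rho> v j"]
      A.\<pi>_nth B.\<pi>_nth assms uv by simp
qed

text \<open>An edge of \<open>Gs i\<close> is lifted to an edge of \<open>G\<close> of colour
  \<open>i\<close> and projected again by \<open>\<rho>\<close>; the weight is that of the lifted
  edge on both sides.\<close>

lemma same_class_edge:
  assumes ij: "i < m" "j < n" and col: "\<And>e. A.col e = i \<longleftrightarrow> B.col e = j"
    and uv: "u \<in> vertices G" "v \<in> vertices G" and e: "{\<pi> u i, \<pi> v i} \<in> edges (Gs i)"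
  shows "{\<rho> u j, \<rho> v j} \<in> edges (Hs j)"
    "weight (Gs i) {\<pi> u i, \<pi> v i} = weight (Hs j) {\<rho> u j, \<rho> v j}"
proof -
  obtain a b where ab: "{a, b} \<in> edges G" "A.col {a, b} = i" "{\<pi> u i, \<pi> v i} = {\<pi> a i, \<pi> b i}"
    "a \<in> vertices G" "b \<in> vertices G"
    using A.factor_edge_parent[OF ij(1) e] by blast
  have "\<pi> u i = \<pi> a i \<and> \<pi> v i = \<pi> b i \<or> \<pi> u i = \<pi> b i \<and> \<pi> v i = \<pi> a i"
    using ab(3) by (auto simp: doubleton_eq_iff)
  then have "{\<rho> u j, \<rho> v j} = {\<rho> a j, \<rho> b j}"
    using same_class_coords[OF ij col] uv ab(4,5) by auto
  moreover have "B.col {a, b} = j"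
    using ab(2) col by simp
  ultimately show "{\<rho> u j, \<rho> v j} \<in> edges (Hs j)"
    "weight (Gs i) {\<pi> u i, \<pi> v i} = weight (Hs j) {\<rho> u j, \<rho> v j}"
    using A.col_edge(4)[OF ab(1,2)] B.col_edge(2,4)[OF ab(1)] ab(3) by simp_all
qed

lemma same_class_isomorphic:
  assumes ij: "i < m" "j < n" and col: "\<And>e. A.col e = i \<longleftrightarrow> B.col e = j"
  shows "wgraph_isomorphic (Gs i) (Hs j)"
proof -
  \<comment> \<open>Exchanging the roles yields the converse direction for adjacency.\<close>
  interpret BA: two_pseudofactorizations G n Hs \<rho> m Gs \<pi> ..
  have coords: "\<pi> u i = \<pi> v i \<longleftrightarrow> \<rho> u j = \<rho> v j" if "u \<in> vertices G" "v \<in> vertices G" for u v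
    using same_class_coords[OF ij col that] .
  define f where "f x = \<rho> (SOME u. u \<in> vertices G \<and> \<pi> u i = x) j" for x
  have f: "f (\<pi> u i) = \<rho> u j" if u: "u \<in> vertices G" for u
  proof -
    have "\<exists>v. v \<in> vertices G \<and> \<pi> v i = \<pi> u i"
      using u by blast
    from someI_ex[OF this] show ?thesis
      unfolding f_def using coords u by blast
  qed
  have "inj_on f (vertices (Gs i))"
    unfolding A.vertices_factor[OF ij(1)] by (auto intro!: inj_onI simp: f coords)
  moreover have "f ` vertices (Gs i) = vertices (Hs j)"
    unfolding A.vertices_factor[OF ij(1)] B.vertices_factor[OF ij(2)] image_image
    using f by (intro image_cong) auto
  moreover have "{\<pi> u i, \<pi> v i} \<in> edges (Gs i) \<longleftrightarrow> {\<rho> u j, \<rho> v j} \<in> edges (Hs j)"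
    if "u \<in> vertices G" "v \<in> vertices G" for u v
    using same_class_edge(1)[OF ij col that] BA.same_class_edge(1)[OF ij(2,1) col[symmetric] that]
    by blast
  ultimately have "wgraph_iso_map f (Gs i) (Hs j)"
    using same_class_edge(2)[OF ij col] unfolding wgraph_iso_map_def bij_betw_def
    by (auto simp: A.vertices_factor[OF ij(1)] f)
  then show ?thesis
    by (auto simp: wgraph_isomorphic_def)
qed

text \<open>Edges with a common parent edge are in the Djokovic--Winkler relation, so the second
  colouring descends to the factors of the first pseudofactorization.\<close>

lemma different_colours_factor:
  assumes i: "i < m" and d: "d \<in> edges G" "A.col d = i" and d': "d' \<in> edges G" "A.col d' = i"
    and neq: "B.col d \<noteq> B.col d'"
    and ab: "{a, b} = (\<lambda>u. \<pi> u i) ` d" and xy: "{x, y} = (\<lambda>u. \<pi> u i) ` d'"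
  shows "dw_diff (Gs i) a b x y = 0" "{a, b} \<noteq> {x, y}"
proof -
  obtain u v where uv: "d = {u, v}" "{u, v} \<in> edges G" "u \<in> vertices G" "v \<in> vertices G"
    using A.edgeE[OF d(1)] by blast
  obtain s t where st: "d' = {s, t}" "{s, t} \<in> edges G" "s \<in> vertices G" "t \<in> vertices G"
    using A.edgeE[OF d'(1)] by blast
  have "dw_diff (Gs i) (\<pi> u i) (\<pi> v i) (\<pi> s i) (\<pi> t i) = 0"
    using A.dw_diff_factor[OF uv(2) _ st(3,4)] B.dw_diff_eq_0[OF uv(2) st(2)] d(2) neq
    by (simp add: uv(1) st(1))
  moreover have "a = \<pi> u i \<and> b = \<pi> v i \<or> a = \<pi> v i \<and> b = \<pi> u i"
    using ab uv(1) by (auto simp: doubleton_eq_iff)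
  moreover have "x = \<pi> s i \<and> y = \<pi> t i \<or> x = \<pi> t i \<and> y = \<pi> s i"
    using xy st(1) by (auto simp: doubleton_eq_iff)
  ultimately show 0: "dw_diff (Gs i) a b x y = 0"
    by (auto simp: dw_diff_def)
  interpret Gi: weighted_graph "Gs i" by (rule A.factor_graph[OF i])
  have "{a, b} \<in> edges (Gs i)"
    using A.col_edge(2)[OF uv(2)] d(2) ab uv(1) by simp
  then have "a \<in> vertices (Gs i)" "b \<in> vertices (Gs i)" "a \<noteq> b"
    using Gi.edge_ends by auto
  then have "gdist (Gs i) a b \<noteq> 0" "gdist (Gs i) b a = gdist (Gs i) a b"
    "gdist (Gs i) a a = 0" "gdist (Gs i) b b = 0"
    by (simp_all add: Gi.gdist_eq_0_iff Gi.gdist_commute)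
  \<comment> \<open>An edge is related to itself: for equal edges \<open>dw_diff\<close> would be
    plus or minus twice the distance of \<open>a\<close> and \<open>b\<close>.\<close>
  then show "{a, b} \<noteq> {x, y}"
    using 0 by (auto simp: doubleton_eq_iff dw_diff_def)
qed

text \<open>Two values of \<open>B.col\<close> on the class would induce a colouring of
  \<open>Gs i\<close> with unrelated colours, contradicting \<open>not_irreducible\<close>.\<close>

lemma irreducible_one_colour:
  assumes i: "i < m" and irr: "irreducible_wgraph (Gs i)"
    and e: "e \<in> edges G" "A.col e = i" and e': "e' \<in> edges G" "A.col e' = i"
  shows "B.col e = B.col e'"
proof (rule ccontr)
  assume neq: "B.col e \<noteq> B.col e'"
  let ?p = "(`) (\<lambda>u. \<pi> u i)"
  define lift where "lift g = (SOME d. d \<in> edges G \<and> A.col d = i \<and> ?p d = g)" for g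
  \<comment> \<open>All colours other than that of \<open>e\<close> are merged, so exactly two
    colours remain and \<open>e\<close> and \<open>e'\<close> witness that both occur.\<close>
  define c where "c g = (if B.col (lift g) = B.col e then 0 else 1 :: nat)" for g
  have lift: "lift (?p d) \<in> edges G" "A.col (lift (?p d)) = i" "?p (lift (?p d)) = ?p d"
    if "d \<in> edges G" "A.col d = i" for d
  proof -
    have "\<exists>d'. d' \<in> edges G \<and> A.col d' = i \<and> ?p d' = ?p d"
      using that by blast
    from someI_ex[OF this] show "lift (?p d) \<in> edges G" "A.col (lift (?p d)) = i"
      "?p (lift (?p d)) = ?p d"
      unfolding lift_def by auto
  qed
  have edge_p: "\<exists>d. d \<in> edges G \<and> A.col d = i \<and> g = ?p d" if "g \<in> edges (Gs i)" for g
    using that by (rule A.factor_edge_parent[OF i]) force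
  have p_edge: "?p d \<in> edges (Gs i)" if d: "d \<in> edges G" "A.col d = i" for d
  proof -
    obtain u v where "d = {u, v}" "{u, v} \<in> edges G"
      using A.edgeE[OF d(1)] by blast
    then show ?thesis
      using A.col_edge(2)[of u v i] d(2) by simp
  qed
  \<comment> \<open>The choice made by \<open>lift\<close> is harmless: edges with the same parent
    have the same second colour.\<close>
  have col_lift: "B.col (lift (?p d)) = B.col d" if d: "d \<in> edges G" "A.col d = i" for d
  proof (rule ccontr)
    assume *: "B.col (lift (?p d)) \<noteq> B.col d"
    obtain u v where "d = {u, v}"
      using A.edgeE[OF d(1)] by blast
    then have "{\<pi> u i, \<pi> v i} = ?p d"
      by simp
    then show False
      using different_colours_factor(2)[OF i lift(1,2)[OF d] d *, of "\<pi> u i" "\<pi> v i" "\<pi> u i" "\<pi> v i"]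
        lift(3)[OF d] by simp
  qed
  interpret Gi: weighted_graph "Gs i" by (rule A.factor_graph[OF i])
  have "dw_colouring (Gs i) c 2"
  proof
    show "minimal_wgraph (Gs i)"
      by (rule A.minimal_factor[OF i])
    show "c g < 2" for g
      by (simp add: c_def)
    fix a b x y assume ab: "{a, b} \<in> edges (Gs i)" and xy: "{x, y} \<in> edges (Gs i)"
      and neq: "c {a, b} \<noteq> c {x, y}"
    obtain d d' where d: "d \<in> edges G" "A.col d = i" "{a, b} = ?p d"
      and d': "d' \<in> edges G" "A.col d' = i" "{x, y} = ?p d'"
      using edge_p[OF ab] edge_p[OF xy] by blast
    have "B.col d \<noteq> B.col d'"
      using neq col_lift[OF d(1,2)] col_lift[OF d'(1,2)] unfolding c_def d(3) d'(3) by auto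
    from different_colours_factor(1)[OF i d(1,2) d'(1,2) this d(3) d'(3)]
    show "dw_diff (Gs i) a b x y = 0" .
  qed
  then interpret C: dw_colouring "Gs i" c 2 .
  have "c (?p e) = 0" "c (?p e') = 1"
    using col_lift[OF e] col_lift[OF e'] neq by (simp_all add: c_def)
  then have "\<exists>g\<in>edges (Gs i). c g = j" if "j < 2" for j
    using that p_edge[OF e] p_edge[OF e'] by (auto simp: less_2_cases_iff)
  then have "\<not> irreducible_wgraph (Gs i)"
    by (intro C.not_irreducible) auto
  then show False
    using irr by contradiction
qed

lemma irreducible_colour_map:
  assumes "\<And>i. i < m \<Longrightarrow> irreducible_wgraph (Gs i)"
    and "\<And>i. i < m \<Longrightarrow> \<exists>e\<in>edges G. A.col e = i"
  obtains \<sigma> where "\<And>e. e \<in> edges G \<Longrightarrow> B.col e = \<sigma> (A.col e)" "\<And>i. i < m \<Longrightarrow> \<sigma> i < n"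
proof -
  define \<sigma> where "\<sigma> i = B.col (SOME e. e \<in> edges G \<and> A.col e = i)" for i
  have some: "(SOME e. e \<in> edges G \<and> A.col e = i) \<in> edges G"
    "A.col (SOME e. e \<in> edges G \<and> A.col e = i) = i" if "i < m" for i
    using someI_ex[of "\<lambda>e. e \<in> edges G \<and> A.col e = i"] assms(2)[OF that] by blast+
  show thesis
  proof
    show "B.col e = \<sigma> (A.col e)" if e: "e \<in> edges G" for e
      unfolding \<sigma>_def using A.col_less[OF e]
      by (intro irreducible_one_colour[OF _ _ e refl] some assms(1))
    show "\<sigma> i < n" if "i < m" for i
      unfolding \<sigma>_def by (intro B.col_less some that)
  qed
qed

end

section \<open>The one-vertex graph and the matching of colours\<close>

text \<open>Without edges there are no colours to compare, so this case is settled directly.\<close>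

lemma pseudofactors_one_vertex:
  assumes "one_vertex G" "pseudofactorization m Gs G"
  shows "m = 1" "one_vertex (Gs 0)" "edges (Gs 0) = {}"
proof -
  obtain \<pi> where \<pi>: "pseudofactor_map \<pi> m Gs G" and m: "1 \<le> m"
    and Gs: "\<And>i. i < m \<Longrightarrow> weighted_graph (Gs i)"
    and one: "\<And>i. i < m \<Longrightarrow> one_vertex (Gs i) \<Longrightarrow> m = 1"
    using assms(2) unfolding pseudofactorization_def by blast
  interpret G0: weighted_graph "Gs 0"
    using Gs m by simp
  obtain u where "vertices G = {u}"
    using assms(1) by (auto simp: one_vertex_def card_1_singleton_iff)
  then have "vertices (Gs 0) \<subseteq> {\<pi> u 0}"
    using \<pi> m unfolding pseudofactor_map_def by force
  then have "vertices (Gs 0) = {\<pi> u 0}"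
    using G0.vertices_nonempty by blast
  then show one0: "one_vertex (Gs 0)"
    by (simp add: one_vertex_def)
  then show "edges (Gs 0) = {}"
    using G0.edge_not_one_vertex by blast
  show "m = 1"
    using one m one0 by auto
qed

lemma one_vertex_isomorphic:
  assumes "one_vertex G" "edges G = {}" "one_vertex H" "edges H = {}"
  shows "wgraph_isomorphic G H"
proof -
  obtain u v where "vertices G = {u}" "vertices H = {v}"
    using assms by (auto simp: one_vertex_def card_1_singleton_iff)
  then have "wgraph_iso_map (\<lambda>_. v) G H"
    using assms by (auto simp: wgraph_iso_map_def bij_betw_def)
  then show ?thesis
    by (auto simp: wgraph_isomorphic_def)
qed

text \<open>As \<open>G\<close> is not \<open>K1\<close>, no factor is; each factor therefore has an
  edge, and an edge of \<open>G\<close> with that parent has its colour.\<close>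

lemma pseudofactorizationE:
  assumes "weighted_graph G" "minimal_wgraph G" "\<not> one_vertex G" "pseudofactorization m Gs G"
  obtains \<pi> where "pseudofactors G m Gs \<pi>"
    "\<And>i. i < m \<Longrightarrow> \<exists>e\<in>edges G. pseudofactors.col G m Gs \<pi> e = i"
proof -
  obtain \<pi> where \<pi>: "pseudofactor_map \<pi> m Gs G"
    and Gs: "\<And>i. i < m \<Longrightarrow> weighted_graph (Gs i)" "\<And>i. i < m \<Longrightarrow> \<not> one_vertex (Gs i)"
    using assms(3,4) unfolding pseudofactorization_def by blast
  interpret pseudofactors G m Gs \<pi>
    using assms \<pi> Gs by (intro pseudofactors.intro pseudofactors_axioms.intro graph_family.intro)
  have "\<exists>e\<in>edges G. col e = i" if i: "i < m" for i
  proof -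
    obtain g where "g \<in> edges (Gs i)"
      using weighted_graph.one_vertex_or_edge[OF Gs(1)] Gs(2) i by blast
    then show ?thesis
      by (rule factor_edge_parent[OF i]) blast
  qed
  then show thesis
    using that pseudofactors_axioms by blast
qed

theorem theorem1p2:
  fixes G :: "'a wgraph"
    and Gs :: "nat \<Rightarrow> 'b wgraph" and p :: nat
    and Hs :: "nat \<Rightarrow> 'c wgraph" and r :: nat
  assumes "weighted_graph G" and "minimal_wgraph G"
    and "pseudofactorization p Gs G" and "\<forall>i<p. irreducible_wgraph (Gs i)"
    and "pseudofactorization r Hs G" and "\<forall>j<r. irreducible_wgraph (Hs j)"
  shows "p = r \<and>
         (\<exists>\<sigma>. bij_betw \<sigma> {..<p} {..<r} \<and> (\<forall>i<p. wgraph_isomorphic (Gs i) (Hs (\<sigma> i))))"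
proof (cases "one_vertex G")
  case True
  note G = pseudofactors_one_vertex[OF True assms(3)]
  note H = pseudofactors_one_vertex[OF True assms(5)]
  have "wgraph_isomorphic (Gs 0) (Hs 0)"
    using one_vertex_isomorphic[OF G(2,3) H(2,3)] .
  then show ?thesis
    using G(1) H(1) by (auto intro!: exI[of _ id])
next
  case False
  obtain \<pi> where \<pi>: "pseudofactors G p Gs \<pi>"
    "\<And>i. i < p \<Longrightarrow> \<exists>e\<in>edges G. pseudofactors.col G p Gs \<pi> e = i"
    using pseudofactorizationE[OF assms(1,2) False assms(3)] by blast
  obtain \<rho> where \<rho>: "pseudofactors G r Hs \<rho>"
    "\<And>i. i < r \<Longrightarrow> \<exists>e\<in>edges G. pseudofactors.col G r Hs \<rho> e = i"
    using pseudofactorizationE[OF assms(1,2) False assms(5)] by blast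
  interpret AB: two_pseudofactorizations G p Gs \<pi> r Hs \<rho>
    by (intro two_pseudofactorizations.intro \<pi> \<rho>)
  interpret BA: two_pseudofactorizations G r Hs \<rho> p Gs \<pi>
    by (intro two_pseudofactorizations.intro \<pi> \<rho>)
  obtain \<sigma> where \<sigma>: "\<And>e. e \<in> edges G \<Longrightarrow> AB.B.col e = \<sigma> (AB.A.col e)" "\<And>i. i < p \<Longrightarrow> \<sigma> i < r"
    using AB.irreducible_colour_map \<pi>(2) assms(4) by metis
  obtain \<tau> where \<tau>: "\<And>e. e \<in> edges G \<Longrightarrow> AB.A.col e = \<tau> (AB.B.col e)" "\<And>j. j < r \<Longrightarrow> \<tau> j < p"
    using BA.irreducible_colour_map \<rho>(2) assms(6) by metis
  \<comment> \<open>An edge of colour \<open>i\<close> exists, and translating its colour back and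
    forth returns \<open>i\<close>.\<close>
  have inv: "\<tau> (\<sigma> i) = i" if "i < p" for i
    using \<pi>(2)[OF that] \<sigma>(1) \<tau>(1) by metis
  have inv': "\<sigma> (\<tau> j) = j" if "j < r" for j
    using \<rho>(2)[OF that] \<sigma>(1) \<tau>(1) by metis
  have bij: "bij_betw \<sigma> {..<p} {..<r}"
    using inv inv' \<sigma>(2) \<tau>(2) by (intro bij_betw_byWitness[where f' = \<tau>]) auto
  moreover have "p = r"
    using bij_betw_same_card[OF bij] by simp
  moreover have "wgraph_isomorphic (Gs i) (Hs (\<sigma> i))" if i: "i < p" for i
  proof (rule AB.same_class_isomorphic[OF i \<sigma>(2)[OF i]])
    fix e
    show "AB.A.col e = i \<longleftrightarrow> AB.B.col e = \<sigma> i"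
    proof (cases "e \<in> edges G")
      case True
      then show ?thesis
        using \<sigma>(1) \<tau>(1) inv[OF i] by metis
    next
      \<comment> \<open>Non-edges have the colours \<open>p\<close> and \<open>r\<close>, which
        differ from \<open>i\<close> and \<open>\<sigma> i\<close>.\<close>
      case False
      then show ?thesis
        using i \<sigma>(2)[OF i] by (simp add: AB.A.col_def AB.B.col_def)
    qed
  qed
  ultimately show ?thesis
    by blast
qed

end
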